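(* Let $E$ be a real linear space and $d\in\mathbb{N}$ (so $d\ge1$). Suppose that: (a) $h\in C(E)$, $h(t)>0$ for all $t\in E$, and $h$ is not identically equal to $h(0)$ on $E$; (b) $\varphi$ is continuous on $[0,+\infty)$ and $\varphi(0)>0$; (c) the function $K(x,t):=(h(t))^{-\frac d2}\varphi\left(\frac{\|x\|_2^2}{h(t)}\right)$ belongs to $\Phi(\mathbb{R}^d\times E)$. If $\int_0^{+\infty}|\varphi(u^2)|u^{m-1}\,du<+\infty$ for some integer $m$ with $1\le m\le d$, and the function $g_m$ is real-analytic on $(0,+\infty)$, where $$g_m(s):=\int_0^{+\infty}\varphi(u^2)u^{m-1}j_{\frac m2-1}(su)\,du,$$ then the function $f_m(s):=s^{m-d}g_m(s)$ is strictly decreasing on $(0,+\infty)$ and $g_m(s)>0$ for all $s>0$.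
   Context: For a real linear space $E$, $\Phi(E)$ denotes the set of positive definite functions on $E$: functions $f:E\to\mathbb{C}$ such that for every finite collection $\xi_1,\dots,\xi_n\in E$ and all $a_1,\dots,a_n\in\mathbb{C}$, $\sum_{i,j=1}^n a_i f(\xi_i-\xi_j)\overline{a_j}\ge 0$ (real and nonnegative). No continuity is part of this definition. $C(E)$: if $\dim E=n<\infty$ with basis $e_1,\dots,e_n$, then $f\in C(E)$ means that $(x_1,\dots,x_n)\mapsto f(x_1e_1+\dots+x_ne_n)$ is continuous on $\mathbb{R}^n$; if $\dim E=\infty$, then $f\in C(E)$ means that the restriction of $f$ to every finite-dimensional linear subspace $E_0$ of $E$ belongs to $C(E_0)$. $j_\lambda(u):=J_\lambda(u)/u^\lambda$, where $J_\lambda$ is the Bessel function of the first kind (with $j_\lambda(0)$ defined by continuity). $\|\cdot\|_2$ is the Euclidean norm on $\mathbb{R}^d$. *)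

theory Defs
  imports "HOL-Analysis.Analysis"
begin

(* The order on complex numbers is the one from HOL-Library.Complex_Order: 0 <= z means that z is
   real and nonnegative, and w < z means Re w < Re z and Im w = Im z. *)

definition pos_def_functions :: "('e::real_vector \<Rightarrow> complex) set" where
  "pos_def_functions = {f. \<forall>(n::nat) (\<xi>::nat \<Rightarrow> 'e) (a::nat \<Rightarrow> complex).
     0 \<le> (\<Sum>i<n. \<Sum>j<n. a i * f (\<xi> i - \<xi> j) * cnj (a j))}"

definition finite_dim_subspace :: "'e::real_vector set \<Rightarrow> bool" where
  "finite_dim_subspace S \<longleftrightarrow> (\<exists>B. finite B \<and> span B = S)"

(* Euclidean_space n is R^n, realised as the sequences that vanish from index n on.
   The list es enumerates a basis of S. *)
definition continuous_in_coordinates ::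
    "'e::real_vector set \<Rightarrow> ('e \<Rightarrow> 'b::topological_space) \<Rightarrow> bool" where
  "continuous_in_coordinates S f \<longleftrightarrow>
     (\<forall>es. distinct es \<and> independent (set es) \<and> span (set es) = S \<longrightarrow>
        continuous_map (Euclidean_space (length es)) euclidean
          (\<lambda>x. f (\<Sum>i<length es. x i *\<^sub>R es ! i)))"

definition C_functions :: "('e::real_vector \<Rightarrow> 'b::topological_space) set" where
  "C_functions = {f.
     if finite_dim_subspace (UNIV :: 'e set) then continuous_in_coordinates UNIV f
     else (\<forall>S. finite_dim_subspace S \<longrightarrow> continuous_in_coordinates S f)}"

(* The series for the Bessel function of the first kind; meant for u > 0 only, since the powers
   are real ones and 0 powr a = 0. *)
definition bessel_J :: "real \<Rightarrow> real \<Rightarrow> real" where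
  "bessel_J \<nu> u =
     (\<Sum>k. (-1) ^ k / (fact k * Gamma (real k + \<nu> + 1)) * (u / 2) powr (2 * real k + \<nu>))"

(* Meant for u >= 0. *)
definition bessel_j :: "real \<Rightarrow> real \<Rightarrow> real" where
  "bessel_j \<nu> u =
     (if u = 0 then Lim (at_right 0) (\<lambda>v. bessel_J \<nu> v / v powr \<nu>)
      else bessel_J \<nu> u / u powr \<nu>)"

definition real_analytic_on :: "(real \<Rightarrow> 'b::real_normed_vector) \<Rightarrow> real set \<Rightarrow> bool" where
  "real_analytic_on g S \<longleftrightarrow>
     (\<forall>x\<in>S. \<exists>r>0. \<exists>c. \<forall>y. \<bar>y - x\<bar> < r \<longrightarrow> (\<lambda>n. (y - x) ^ n *\<^sub>R c n) sums g y)"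

definition bessel_transform :: "nat \<Rightarrow> (real \<Rightarrow> complex) \<Rightarrow> real \<Rightarrow> complex" where
  "bessel_transform m \<phi> s =
     (LINT u:{0..}|lborel. \<phi> (u\<^sup>2) * of_real (u ^ (m - 1) * bessel_j (real m / 2 - 1) (s * u)))"

end

theory Submission
  imports Defs "HOL-Probability.Probability" "HOL-Complex_Analysis.Complex_Analysis"
begin

text \<open>
  Let \<open>\<nu> = m/2 - 1\<close>. The Fourier transform in \<open>x \<in> \<real>\<^sup>m\<close> of a positive definite function of \<open>(x, t)\<close>
  is, for each fixed frequency, positive definite in \<open>t\<close>. For \<open>K\<close> this transform is a positive
  constant times \<open>f(s sqrt (h t))\<close>, where \<open>s\<close> is the length of the frequency. Positive definiteness
  in \<open>t\<close> gives \<open>f(s sqrt (h 0)) \<ge> \<bar>f(s sqrt (h t))\<bar>\<close>, and applied to \<open>K(0, \<cdot>)\<close> it gives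
  \<open>h 0 \<le> h t\<close>. Since \<open>h\<close> is continuous and not constant, \<open>h t / h 0\<close> takes all values in some
  \<open>[1, q\<^sup>2]\<close> with \<open>q > 1\<close>, so \<open>f\<close> is nonnegative and nonincreasing. If \<open>f\<close> were not strictly
  decreasing, it would be constant on an interval, hence by analyticity \<open>g s = C s\<^sup>d\<^sup>-\<^sup>m\<close> on the whole
  half-line. Integrating \<open>g (\<sigma> v)\<close> against \<open>v\<^sup>m\<^sup>-\<^sup>1 exp (-v\<^sup>2/2)\<close>, which is self-dual under the Hankel
  transform, turns this into \<open>C' \<sigma>\<^sup>d = \<integral> \<phi>(w\<^sup>2/\<sigma>\<^sup>2) w\<^sup>m\<^sup>-\<^sup>1 exp (-w\<^sup>2/2) dw\<close>. As \<open>\<sigma> \<rightarrow> \<infinity>\<close> the right-hand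
  side tends to a positive multiple of \<open>\<phi> 0 > 0\<close>, which no multiple of \<open>\<sigma>\<^sup>d\<close> does.
\<close>

section \<open>The Bessel kernel as an entire function\<close>

text \<open>
  \<open>bessel_kernel m u\<close> is \<open>2\<^sup>\<nu> j\<^sub>\<nu>(u)\<close>. As an even power series it has no special case at 0, and it is
  normalised so that the Fourier transform of the unit ball of \<open>\<real>\<^sup>m\<close> is
  \<open>\<pi>\<^sup>m\<^sup>/\<^sup>2 bessel_kernel (m + 2)\<close>.
\<close>

definition kernel_coeff :: "nat \<Rightarrow> nat \<Rightarrow> real" where
  "kernel_coeff m k = (-1) ^ k / (4 ^ k * fact k * Gamma (real k + real m / 2))"

definition kernel_series :: "nat \<Rightarrow> real \<Rightarrow> real" where
  "kernel_series m y = (\<Sum>k. kernel_coeff m k * y ^ k)"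

definition bessel_kernel :: "nat \<Rightarrow> real \<Rightarrow> real" where
  "bessel_kernel m x = kernel_series m (x\<^sup>2)"

text \<open>Each step of the functional equation multiplies Gamma by
  \<open>real k + real m / 2\<close>, which is at least 1/2. The bound is crude, but the factor
  \<open>4 ^ k\<close> in \<open>kernel_coeff\<close> absorbs the loss \<open>2 ^ k\<close>.\<close>

lemma Gamma_shift_ge:
  assumes "m \<ge> 1"
  shows "Gamma (real k + real m / 2) \<ge> Gamma (real m / 2) / 2 ^ k"
proof (induction k)
  case (Suc k)
  have pos: "Gamma (real k + real m / 2) > 0" using assms by (intro Gamma_real_pos) auto
  have "Gamma (real (Suc k) + real m / 2) = Gamma ((real k + real m / 2) + 1)"
    by (simp add: algebra_simps)
  also have "\<dots> = (real k + real m / 2) * Gamma (real k + real m / 2)"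
    using assms by (intro Gamma_plus1) (auto simp: nonpos_Ints_def)
  also have "\<dots> \<ge> 1/2 * Gamma (real k + real m / 2)"
    using pos assms by (intro mult_right_mono) auto
  finally have "Gamma (real (Suc k) + real m / 2) \<ge> 1 / 2 * (Gamma (real m / 2) / 2 ^ k)"
    using Suc by linarith
  then show ?case by simp
qed auto

lemma abs_kernel_coeff_le:
  assumes "m \<ge> 1"
  shows "\<bar>kernel_coeff m k\<bar> \<le> 1 / Gamma (real m / 2) * (1 / fact k)"
proof -
  have pos: "Gamma (real m / 2) > 0" using assms by (intro Gamma_real_pos) auto
  have pos': "Gamma (real k + real m / 2) > 0" using assms by (intro Gamma_real_pos) auto
  have "Gamma (real m / 2) = 2 ^ k * (Gamma (real m / 2) / 2 ^ k)" by simp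
  also have "\<dots> \<le> 4 ^ k * Gamma (real k + real m / 2)"
    using Gamma_shift_ge[OF assms, of k] pos by (intro mult_mono power_mono) auto
  finally show ?thesis using pos pos'
    by (simp add: kernel_coeff_def abs_mult power_abs field_simps)
qed

lemma summable_abs_kernel_coeff:
  assumes "m \<ge> 1"
  shows "summable (\<lambda>k. \<bar>kernel_coeff m k\<bar> * \<bar>y\<bar> ^ k)"
proof (rule summable_comparison_test')
  show "summable (\<lambda>k. 1 / Gamma (real m / 2) * (\<bar>y\<bar> ^ k /\<^sub>R fact k))"
    by (intro summable_mult summable_exp_generic)
  show "norm (\<bar>kernel_coeff m k\<bar> * \<bar>y\<bar> ^ k) \<le> 1 / Gamma (real m / 2) * (\<bar>y\<bar> ^ k /\<^sub>R fact k)" for k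
    using mult_right_mono[OF abs_kernel_coeff_le[OF assms, of k], of "\<bar>y\<bar> ^ k"]
    by (simp add: field_simps)
qed

lemma summable_kernel_coeff: "m \<ge> 1 \<Longrightarrow> summable (\<lambda>k. kernel_coeff m k * y ^ k)"
  by (rule summable_norm_cancel, simp only: real_norm_def abs_mult power_abs, rule summable_abs_kernel_coeff)

text \<open>The functional equation of Gamma at \<open>k + m / 2\<close>, read as a recursion
  between the dimensions \<open>m\<close> and \<open>m + 2\<close>. It is the coefficient form of
  the differential relation between the two kernels.\<close>

lemma kernel_coeff_step:
  assumes "m \<ge> 1"
  shows "(real m + 2 * real k) * kernel_coeff (m + 2) k = 2 * kernel_coeff m k"
proof -
  define c where "c = real k + real m / 2"
  have c: "c > 0" "real m + 2 * real k = 2 * c" using assms by (auto simp: c_def)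
  have c1: "real k + real (m + 2) / 2 = c + 1"
    unfolding c_def by (simp add: add_divide_distrib)
  have "Gamma (c + 1) = c * Gamma c"
    using c(1) by (intro Gamma_plus1) (auto elim!: nonpos_Ints_cases)
  then have 1: "kernel_coeff (m + 2) k = (-1) ^ k / (4 ^ k * fact k * (c * Gamma c))"
    by (subst kernel_coeff_def, subst c1, simp only:)
  have 2: "kernel_coeff m k = (-1) ^ k / (4 ^ k * fact k * Gamma c)"
    unfolding c_def by (rule kernel_coeff_def)
  have "c * kernel_coeff (m + 2) k = kernel_coeff m k"
    unfolding 1 2 using c(1) by simp
  then show ?thesis unfolding c(2) by (simp only: mult.assoc)
qed

text \<open>The relation follows from \<open>kernel_coeff_step\<close> by comparing coefficients.
  The variable \<open>y\<close> later stands for the square of the kernel's argument; only the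
  existence of \<open>D\<close> and this relation matter then.\<close>

lemma kernel_series_deriv:
  assumes "m \<ge> 1"
  obtains D where "(kernel_series (m + 2) has_real_derivative D) (at y)"
    "real m * kernel_series (m + 2) y + 2 * y * D = 2 * kernel_series m y"
proof -
  define D where "D = (\<Sum>k. diffs (kernel_coeff (m + 2)) k * y ^ k)"
  have sm: "summable (\<lambda>k. kernel_coeff (m + 2) k * z ^ k)" for z
    by (intro summable_kernel_coeff) auto
  have 1: "(kernel_series (m + 2) has_real_derivative D) (at y)"
    unfolding kernel_series_def[abs_def] D_def
    by (rule termdiffs_strong_converges_everywhere) (rule sm)
  have sd: "summable (\<lambda>k. diffs (kernel_coeff (m + 2)) k * y ^ k)"
    by (rule termdiff_converges_all) (rule sm)
  have "(\<lambda>k. real k * kernel_coeff (m + 2) k * y ^ (k - Suc 0)) sums D"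
    using diffs_equiv[OF sd] unfolding D_def by simp
  from sums_mult[OF this, of "2 * y"]
  have "(\<lambda>k. 2 * y * (real k * kernel_coeff (m + 2) k * y ^ (k - Suc 0))) sums (2 * y * D)" .
  \<comment> \<open>At \<open>k = 0\<close> the exponent \<open>k - Suc 0\<close> is truncated to 0,
    but the factor \<open>real k\<close> vanishes there.\<close>
  also have "(\<lambda>k. 2 * y * (real k * kernel_coeff (m + 2) k * y ^ (k - Suc 0))) =
     (\<lambda>k. 2 * real k * kernel_coeff (m + 2) k * y ^ k)"
  proof
    fix k show "2 * y * (real k * kernel_coeff (m + 2) k * y ^ (k - Suc 0)) = 2 * real k * kernel_coeff (m + 2) k * y ^ k"
      by (cases k) (auto simp: algebra_simps)
  qed
  finally have A: "(\<lambda>k. 2 * real k * kernel_coeff (m + 2) k * y ^ k) sums (2 * y * D)" .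
  have B: "(\<lambda>k. real m * (kernel_coeff (m + 2) k * y ^ k)) sums (real m * kernel_series (m + 2) y)"
    unfolding kernel_series_def by (intro sums_mult summable_sums sm)
  have C: "(\<lambda>k. 2 * (kernel_coeff m k * y ^ k)) sums (2 * kernel_series m y)"
    unfolding kernel_series_def by (intro sums_mult summable_sums summable_kernel_coeff assms)
  have "(\<lambda>k. real m * (kernel_coeff (m + 2) k * y ^ k) + 2 * real k * kernel_coeff (m + 2) k * y ^ k) = (\<lambda>k. 2 * (kernel_coeff m k * y ^ k))"
  proof
    fix k
    show "real m * (kernel_coeff (m + 2) k * y ^ k) + 2 * real k * kernel_coeff (m + 2) k * y ^ k = 2 * (kernel_coeff m k * y ^ k)"
      using arg_cong[OF kernel_coeff_step[OF assms, of k], of "\<lambda>z. z * y ^ k"]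
      by (simp add: algebra_simps)
  qed
  with sums_add[OF B A] C have "real m * kernel_series (m + 2) y + 2 * y * D = 2 * kernel_series m y"
    by (auto intro: sums_unique2)
  with 1 show ?thesis by (rule that)
qed

lemma continuous_kernel_series:
  assumes "m \<ge> 1"
  shows "continuous_on UNIV (kernel_series m)"
proof -
  have "(kernel_series m has_real_derivative (\<Sum>k. diffs (kernel_coeff m) k * y ^ k)) (at y)" for y
    unfolding kernel_series_def[abs_def]
    by (rule termdiffs_strong_converges_everywhere) (rule summable_kernel_coeff[OF assms])
  thus ?thesis by (meson DERIV_isCont continuous_at_imp_continuous_on)
qed

lemma continuous_bessel_kernel [continuous_intros]:
  assumes "m \<ge> 1" "continuous_on A g"
  shows "continuous_on A (\<lambda>x. bessel_kernel m (g x))"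
  unfolding bessel_kernel_def
  by (intro continuous_on_compose2[OF continuous_kernel_series[OF assms(1)]] continuous_intros assms) auto

lemma borel_measurable_bessel_kernel [measurable]:
  "m \<ge> 1 \<Longrightarrow> bessel_kernel m \<in> borel_measurable borel"
  by (intro borel_measurable_continuous_onI continuous_intros) auto

text \<open>Up to the factor \<open>pi powr (m / 2)\<close>, the function of \<open>r\<close> is the
  Fourier transform of the ball of radius \<open>r\<close> in dimension \<open>m\<close>, so its
  derivative is that of the sphere of radius \<open>r\<close>.\<close>

lemma ball_kernel_deriv:
  assumes "m \<ge> 1"
  shows "((\<lambda>r. r ^ m * bessel_kernel (m + 2) (s * r)) has_real_derivative
     2 * r ^ (m - 1) * bessel_kernel m (s * r)) (at r)"
proof -
  obtain D where D: "(kernel_series (m + 2) has_real_derivative D) (at ((s * r)\<^sup>2))"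
    "real m * kernel_series (m + 2) ((s * r)\<^sup>2) + 2 * (s * r)\<^sup>2 * D = 2 * kernel_series m ((s * r)\<^sup>2)"
    using kernel_series_deriv[OF assms] by blast
  have "((\<lambda>r. (s * r)\<^sup>2) has_real_derivative 2 * s\<^sup>2 * r) (at r)"
    by (auto intro!: derivative_eq_intros simp: power2_eq_square)
  from DERIV_mult[OF DERIV_pow[of m] DERIV_chain2[OF D(1) this]]
  have "((\<lambda>r. r ^ m * bessel_kernel (m + 2) (s * r)) has_real_derivative
      real m * r ^ (m - 1) * kernel_series (m + 2) ((s * r)\<^sup>2) + D * (2 * s\<^sup>2 * r) * r ^ m) (at r)"
    unfolding bessel_kernel_def by simp
  also have "real m * r ^ (m - 1) * kernel_series (m + 2) ((s * r)\<^sup>2) + D * (2 * s\<^sup>2 * r) * r ^ m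
    = r ^ (m - 1) * (real m * kernel_series (m + 2) ((s * r)\<^sup>2) + 2 * (s * r)\<^sup>2 * D)"
    using assms by (cases m) (auto simp: algebra_simps power2_eq_square)
  also have "\<dots> = 2 * r ^ (m - 1) * bessel_kernel m (s * r)"
    unfolding D(2) bessel_kernel_def by simp
  finally show ?thesis .
qed

lemma bessel_kernel_0: "bessel_kernel m 0 = 1 / Gamma (real m / 2)"
  unfolding bessel_kernel_def kernel_series_def power_zero_numeral powser_zero by (simp add: kernel_coeff_def)

text \<open>For \<open>u > 0\<close> the real powers combine as usual, and the limit that defines
  \<open>bessel_j\<close> at 0 does not have to be evaluated.\<close>

lemma bessel_j_eq_kernel:
  assumes "m \<ge> 1" "u > 0"
  shows "bessel_j (real m / 2 - 1) u = 2 powr (1 - real m / 2) * bessel_kernel m u"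
proof -
  define \<nu> where "\<nu> = real m / 2 - 1"
  have "(-1) ^ k / (fact k * Gamma (real k + \<nu> + 1)) * (u / 2) powr (2 * real k + \<nu>)
      = (u / 2) powr \<nu> * (kernel_coeff m k * (u\<^sup>2) ^ k)" for k
  proof -
    have "(u / 2) powr (2 * real k + \<nu>) = (u / 2) powr real (2 * k) * (u / 2) powr \<nu>"
      by (simp add: powr_add)
    also have "(u / 2) powr real (2 * k) = (u\<^sup>2) ^ k / 4 ^ k"
      using assms by (subst powr_realpow) (auto simp: power_mult power_divide)
    finally show ?thesis
      by (simp add: kernel_coeff_def \<nu>_def algebra_simps)
  qed
  then have "bessel_J \<nu> u = (\<Sum>k. (u / 2) powr \<nu> * (kernel_coeff m k * (u\<^sup>2) ^ k))"
    unfolding bessel_J_def by simp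
  also have "\<dots> = (u / 2) powr \<nu> * bessel_kernel m u"
    unfolding bessel_kernel_def kernel_series_def
    by (intro suminf_mult summable_kernel_coeff assms)
  finally show ?thesis using assms
    by (simp add: bessel_j_def \<nu>_def powr_divide powr_diff)
qed

section \<open>Radial functions in Cartesian coordinates\<close>

lemma nn_integral_even_moment:
  "(\<integral>\<^sup>+x. ennreal (indicator {-1..1} x * (x ^ (2 * k) * sqrt (1 - x\<^sup>2) ^ n)) \<partial>lborel) =
      ennreal (Beta (real k + 1 / 2) (real n / 2 + 1))"
proof -
  have "((\<lambda>t. t powr (real k - 1 / 2) * (1 - t) powr (real n / 2)) has_integral
          Beta (real k + 1 / 2) (real n / 2 + 1)) {0..1}"
    using has_integral_Beta_real[of "real k + 1/2" "n / 2 + 1"] by simp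
  from nn_integral_has_integral_lebesgue[OF _ this] have
     "ennreal (Beta (real k + 1 / 2) (real n / 2 + 1)) =
        nn_integral lborel (\<lambda>t. ennreal (t powr (real k - 1 / 2) * (1 - t) powr (real n / 2) *
                                indicator {0^2..1^2} t))"
    by (simp add: mult_ac ennreal_mult' ennreal_indicator)
  \<comment> \<open>The substitution \<open>t = x ^ 2\<close> turns the Beta integral into twice the
    moment over [0, 1], which evenness then spreads over [-1, 1].\<close>
  also have "\<dots> = (\<integral>\<^sup>+ x. ennreal (x\<^sup>2 powr (real k - 1 / 2) * (1 - x\<^sup>2) powr (real n / 2) * (2 * x) *
                          indicator {0..1} x) \<partial>lborel)"
  proof (subst nn_integral_substitution[where g = "\<lambda>x. x ^ 2" and g' = "\<lambda>x. 2 * x"])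
    show "set_borel_measurable borel {0\<^sup>2..1\<^sup>2} (\<lambda>t :: real. t powr (real k - 1 / 2) * (1 - t) powr (real n / 2))"
      unfolding set_borel_measurable_def by measurable
  qed (auto intro!: derivative_eq_intros continuous_intros)
  also have "\<dots> = (\<integral>\<^sup>+ x. 2 * ennreal (x ^ (2 * k) * (1 - x\<^sup>2) powr (real n / 2) * indicator {0..1} x) \<partial>lborel)"
  \<comment> \<open>For \<open>k = 0\<close> the two integrands differ at \<open>x = 0\<close>: the
    left one vanishes there and the right one does not.\<close>
  proof (rule nn_integral_cong_AE, rule AE_mp[OF AE_lborel_singleton[of 0]], rule AE_I2, rule impI)
    fix x :: real assume "x \<noteq> 0"
    show "ennreal (x\<^sup>2 powr (real k - 1 / 2) * (1 - x\<^sup>2) powr (real n / 2) * (2 * x) * indicator {0..1} x)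
      = 2 * ennreal (x ^ (2 * k) * (1 - x\<^sup>2) powr (real n / 2) * indicator {0..1} x)"
    proof (cases "x \<in> {0..1}")
      case True
      with \<open>x \<noteq> 0\<close> have "x > 0" by auto
      have "x\<^sup>2 powr (real k - 1 / 2) = (x powr 2) powr (real k - 1 / 2)"
        using \<open>x > 0\<close> by simp
      also have "\<dots> = x powr (real (2 * k) - 1)"
        unfolding powr_powr by (simp add: right_diff_distrib)
      also have "\<dots> = x ^ (2 * k) / x"
        using \<open>x > 0\<close> powr_realpow[of x "2 * k"] by (simp only: powr_diff) simp
      finally have "x\<^sup>2 powr (real k - 1 / 2) * (1 - x\<^sup>2) powr (real n / 2) * (2 * x) =
          2 * (x ^ (2 * k) * (1 - x\<^sup>2) powr (real n / 2))"
        using \<open>x > 0\<close> by simp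
      then have "ennreal (x\<^sup>2 powr (real k - 1 / 2) * (1 - x\<^sup>2) powr (real n / 2) * (2 * x)) =
          2 * ennreal (x ^ (2 * k) * (1 - x\<^sup>2) powr (real n / 2))"
        by (simp only: ennreal_mult'[of 2] ennreal_numeral)
      then show ?thesis using True by (simp only: indicator_simps mult_1_right)
    qed auto
  qed
  also have "\<dots> = (\<integral>\<^sup>+ x. ennreal (x ^ (2 * k) * (1 - x\<^sup>2) powr (real n / 2) * indicator {0..1} x) \<partial>lborel) +
                    (\<integral>\<^sup>+ x. ennreal (x ^ (2 * k) * (1 - x\<^sup>2) powr (real n / 2) * indicator {0..1} x) \<partial>lborel)"
    (is "_ = ?I + _") by (simp add: mult_2 nn_integral_add)
  also have "?I = (\<integral>\<^sup>+ x. ennreal (x ^ (2 * k) * (1 - x\<^sup>2) powr (real n / 2) * indicator {-1..0} x) \<partial>lborel)"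
    by (subst nn_integral_real_affine[of _ "-1" 0])
       (auto simp: indicator_def intro!: nn_integral_cong)
  hence "?I + ?I = \<dots> + ?I" by simp
  also have "\<dots> = (\<integral>\<^sup>+ x. ennreal (x ^ (2 * k) * (1 - x\<^sup>2) powr (real n / 2) *
                    (indicator {-1..0} x + indicator{0..1} x)) \<partial>lborel)"
    by (subst nn_integral_add [symmetric]) (auto simp: distrib_left intro!: nn_integral_cong ennreal_plus[symmetric])
  also have "\<dots> = (\<integral>\<^sup>+ x. ennreal (x ^ (2 * k) * (1 - x\<^sup>2) powr (real n / 2) * indicator {-1..1} x) \<partial>lborel)"
    by (intro nn_integral_cong_AE AE_I[of _ _ "{0}"]) (auto simp: indicator_def)
  \<comment> \<open>For \<open>n = 0\<close> the endpoints are exceptional, since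
    \<open>0 powr 0\<close> is 0 while \<open>0 ^ 0\<close> is 1.\<close>
  also have "\<dots> = (\<integral>\<^sup>+ x. ennreal (indicator {-1..1} x * (x ^ (2 * k) * sqrt (1 - x\<^sup>2) ^ n)) \<partial>lborel)"
    by (intro nn_integral_cong_AE AE_I[of _ _ "{1, -1}"])
       (auto simp: powr_half_sqrt [symmetric] indicator_def abs_square_le_1
          abs_square_eq_1 powr_def exp_of_nat_mult [symmetric] emeasure_lborel_countable)
  finally show ?thesis ..
qed

lemma has_bochner_integral_even_moment:
  "has_bochner_integral lborel (\<lambda>x. indicator {-1..1} x * (x ^ (2 * k) * sqrt (1 - x\<^sup>2) ^ n))
      (Beta (real k + 1 / 2) (real n / 2 + 1))"
proof (rule has_bochner_integral_nn_integral)
  show "AE x in lborel. 0 \<le> indicator {-1..1} x * (x ^ (2 * k) * sqrt (1 - x\<^sup>2) ^ n)"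
    by (intro AE_I2) (auto simp: indicator_def abs_square_le_1)
  show "0 \<le> Beta (real k + 1 / 2) (real n / 2 + 1)"
    by (auto simp: Beta_def intro!: divide_nonneg_nonneg mult_nonneg_nonneg less_imp_le[OF Gamma_real_pos])
qed (auto simp: nn_integral_even_moment)

text \<open>\<open>Gamma (k + 1 / 2)\<close> is a Pochhammer symbol times \<open>sqrt pi\<close>,
  the doubling formula for the factorial cancels that symbol, and \<open>Gamma (n / 2 + 1)\<close>
  cancels against the ball volume. The index is \<open>n + 3 = (n + 1) + 2\<close> because the ball
  lives in dimension \<open>n + 1\<close>.\<close>

lemma ball_moment_coeff:
  "unit_ball_vol (real n) * ((-1) ^ k / fact (2 * k) * Beta (real k + 1 / 2) (real n / 2 + 1))
    = pi powr (real (n + 1) / 2) * kernel_coeff (n + 3) k"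
proof -
  define p where "p = pochhammer (1 / 2 :: real) k"
  define G where "G = Gamma (real n / 2 + 1)"
  define G' where "G' = Gamma (real k + real (n + 3) / 2)"
  have pos: "p > 0" "G > 0" "G' > 0"
    by (auto simp: p_def G_def G'_def intro!: pochhammer_pos Gamma_real_pos add_nonneg_pos)
  have "pochhammer (1 / 2 :: real) k = Gamma (1 / 2 + real k) / Gamma (1 / 2)"
    by (intro pochhammer_Gamma) auto
  then have 1: "Gamma (real k + 1 / 2) = p * sqrt pi"
    by (simp add: Gamma_one_half_real add.commute p_def)
  have 2: "(fact (2 * k) :: real) = 4 ^ k * p * fact k"
    using fact_double[of k, where ?'a = real] by (simp add: power_mult p_def)
  have "real k + 1 / 2 + (real n / 2 + 1) = real k + real (n + 3) / 2"
    by (simp add: field_simps)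
  with 1 have 3: "Beta (real k + 1 / 2) (real n / 2 + 1) = p * sqrt pi * G / G'"
    by (simp only: Beta_def G_def G'_def)
  have "pi powr (real (n + 1) / 2) = pi powr (real n / 2 + 1 / 2)"
    by (simp add: field_simps)
  then have 4: "pi powr (real (n + 1) / 2) = pi powr (real n / 2) * sqrt pi"
    by (simp only: powr_add powr_half_sqrt) (simp add: powr_half_sqrt)
  show ?thesis
    unfolding unit_ball_vol_def kernel_coeff_def 2 3 4 G_def[symmetric] G'_def[symmetric]
    using pos by simp
qed

text \<open>Expand the cosine in its power series and integrate term by term. The value is divided
  by \<open>unit_ball_vol (real n)\<close> because a slice of the unit ball of dimension
  \<open>n + 1\<close> at height \<open>x\<close> has volume
  \<open>unit_ball_vol (real n) * sqrt (1 - x\<^sup>2) ^ n\<close>.\<close>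

lemma has_bochner_integral_cos_weight:
  "has_bochner_integral lborel (\<lambda>x. indicator {-1..1} x * (cos (s * x) * sqrt (1 - x\<^sup>2) ^ n))
      (pi powr (real (n + 1) / 2) * bessel_kernel (n + 3) s / unit_ball_vol (real n))"
proof -
  define V where "V = unit_ball_vol (real n)"
  define P where "P = pi powr (real (n + 1) / 2)"
  define c where "c k = (-1) ^ k / fact (2 * k) * s ^ (2 * k)" for k :: nat
  define w where "w k x = indicator {-1..1} x * (x ^ (2 * k) * sqrt (1 - x\<^sup>2) ^ n)" for k :: nat and x :: real
  define b where "b k = Beta (real k + 1 / 2) (real n / 2 + 1)" for k
  have V: "V > 0" unfolding V_def by simp
  have cb: "c k * b k = P / V * (kernel_coeff (n + 3) k * (s\<^sup>2) ^ k)" for k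
  proof -
    have "V * (c k * b k) = V * ((-1) ^ k / fact (2 * k) * b k) * (s\<^sup>2) ^ k"
      by (simp add: c_def power_mult)
    also have "\<dots> = P * kernel_coeff (n + 3) k * (s\<^sup>2) ^ k"
      unfolding V_def b_def P_def by (subst ball_moment_coeff) rule
    finally show ?thesis using V by (simp add: field_simps)
  qed
  have wnn: "w k x \<ge> 0" for k x
    by (auto simp: w_def indicator_def abs_square_le_1)
  have b_nn: "b k \<ge> 0" for k
    by (auto simp: b_def Beta_def intro!: divide_nonneg_nonneg mult_nonneg_nonneg less_imp_le[OF Gamma_real_pos])
  have wi: "has_bochner_integral lborel (w k) (b k)" for k
    unfolding w_def[abs_def] b_def by (rule has_bochner_integral_even_moment)
  have fi: "has_bochner_integral lborel (\<lambda>x. c k * w k x) (c k * b k)" for k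
    by (intro has_bochner_integral_mult_right wi) 
  have ni: "has_bochner_integral lborel (\<lambda>x. norm (c k * w k x)) (\<bar>c k\<bar> * b k)" for k
  proof -
    have "(\<lambda>x. norm (c k * w k x)) = (\<lambda>x. \<bar>c k\<bar> * w k x)"
      using wnn[of k] by (auto simp: abs_mult)
    then show ?thesis by (simp only:) (intro has_bochner_integral_mult_right wi)
  qed
  \<comment> \<open>Absolute values only drop the alternating sign, so the integrals of the norms
    are summable by absolute convergence of the kernel series.\<close>
  have "\<bar>c k\<bar> * b k = P / V * (\<bar>kernel_coeff (n + 3) k\<bar> * \<bar>s\<^sup>2\<bar> ^ k)" for k
  proof -
    have "\<bar>c k\<bar> * b k = \<bar>c k * b k\<bar>" using b_nn[of k] by (simp add: abs_mult)
    also have "\<dots> = P / V * (\<bar>kernel_coeff (n + 3) k\<bar> * \<bar>s\<^sup>2\<bar> ^ k)"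
      unfolding cb using V by (simp add: abs_mult P_def power_abs)
    finally show ?thesis .
  qed
  then have sm2: "summable (\<lambda>k. \<bar>c k\<bar> * b k)"
    by (simp only:) (intro summable_mult summable_abs_kernel_coeff, simp)
  have sm1: "summable (\<lambda>k. norm (c k * w k x))" for x
  proof (rule summable_comparison_test')
    show "summable (\<lambda>k. (s\<^sup>2) ^ k /\<^sub>R fact k)"
      by (rule summable_exp_generic)
    show "norm (norm (c k * w k x)) \<le> (s\<^sup>2) ^ k /\<^sub>R fact k" for k
    proof -
      have w1: "w k x \<le> 1"
      proof (cases "x \<in> {-1..1}")
        case True
        then have "x\<^sup>2 \<le> 1" by (auto simp: abs_square_le_1)
        then have "(x\<^sup>2) ^ k * sqrt (1 - x\<^sup>2) ^ n \<le> 1"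
          by (intro mult_le_one power_le_one[of "x\<^sup>2"] power_le_one[of "sqrt (1 - x\<^sup>2)"]) auto
        then show ?thesis using True by (simp add: w_def power_mult)
      qed (simp add: w_def)
      have "norm (norm (c k * w k x)) = (s\<^sup>2) ^ k / fact (2 * k) * w k x"
        using wnn[of k x] by (simp add: c_def abs_mult power_mult)
      also have "\<dots> \<le> (s\<^sup>2) ^ k / fact (2 * k) * 1"
        by (intro mult_left_mono w1) auto
      also have "\<dots> \<le> (s\<^sup>2) ^ k / fact k"
        by (auto intro!: divide_left_mono fact_mono)
      finally show ?thesis by (simp add: divide_inverse mult.commute)
    qed
  qed
  have sumw: "(\<Sum>k. c k * w k x) = indicator {-1..1} x * (cos (s * x) * sqrt (1 - x\<^sup>2) ^ n)" for x
  proof -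
    have "(\<lambda>k. (-1) ^ k / fact (2 * k) * (s * x) ^ (2 * k)) sums cos (s * x)"
      by (rule cos_paired)
    from sums_mult2[OF this, of "indicator {-1..1} x * sqrt (1 - x\<^sup>2) ^ n"]
    have "(\<lambda>k. c k * w k x) sums (cos (s * x) * (indicator {-1..1} x * sqrt (1 - x\<^sup>2) ^ n))"
      by (simp add: c_def w_def power_mult_distrib mult_ac)
    then show ?thesis by (simp add: sums_iff mult_ac)
  qed
  have int: "integrable lborel (\<lambda>x. c k * w k x)" for k
    using fi[of k] by (rule integrable.intros)
  have sm2': "summable (\<lambda>k. \<integral>x. norm (c k * w k x) \<partial>lborel)"
    using sm2 has_bochner_integral_integral_eq[OF ni] by simp
  have A: "integrable lborel (\<lambda>x. \<Sum>k. c k * w k x)"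
    by (rule integrable_suminf[OF int AE_I2[OF sm1] sm2'])
  have B: "(\<lambda>k. \<integral>x. c k * w k x \<partial>lborel) sums (\<integral>x. (\<Sum>k. c k * w k x) \<partial>lborel)"
    by (rule sums_integral[OF int AE_I2[OF sm1] sm2'])
  have "(\<lambda>k. \<integral>x. c k * w k x \<partial>lborel) = (\<lambda>k. P / V * (kernel_coeff (n + 3) k * (s\<^sup>2) ^ k))"
    using has_bochner_integral_integral_eq[OF fi] cb by simp
  moreover have "(\<lambda>k. P / V * (kernel_coeff (n + 3) k * (s\<^sup>2) ^ k)) sums (P / V * bessel_kernel (n + 3) s)"
    unfolding bessel_kernel_def kernel_series_def
    by (intro sums_mult summable_sums summable_kernel_coeff) simp
  ultimately have "(\<integral>x. (\<Sum>k. c k * w k x) \<partial>lborel) = P / V * bessel_kernel (n + 3) s"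
    using B by (auto intro: sums_unique2)
  with A show ?thesis
    unfolding sumw by (simp add: has_bochner_integral_iff P_def V_def)
qed

lemma has_bochner_integral_cos_slice:
  assumes "r > 0"
  shows "has_bochner_integral lborel (\<lambda>x. indicator {-r..r} x * (cos (s * x) * sqrt (r\<^sup>2 - x\<^sup>2) ^ n))
      (r ^ (n + 1) * (pi powr (real (n + 1) / 2) * bessel_kernel (n + 3) (s * r) / unit_ball_vol (real n)))"
    (is "has_bochner_integral _ ?f (_ * ?v)")
proof -
  have "(\<lambda>x. ?f (0 + r * x)) = (\<lambda>x. r ^ n * (indicator {-1..1} x * (cos (s * r * x) * sqrt (1 - x\<^sup>2) ^ n)))"
  proof
    fix x
    have "sqrt (r\<^sup>2 - (r * x)\<^sup>2) = r * sqrt (1 - x\<^sup>2)"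
    proof -
      have "r\<^sup>2 - (r * x)\<^sup>2 = r\<^sup>2 * (1 - x\<^sup>2)" by (simp add: algebra_simps power_mult_distrib)
      then show ?thesis using assms by (simp add: real_sqrt_mult)
    qed
    moreover have "r * x \<in> {-r..r} \<longleftrightarrow> x \<in> {-1..1}"
    proof -
      have "r * x \<in> {-r..r} \<longleftrightarrow> \<bar>r * x\<bar> \<le> r * 1" by (auto simp: abs_le_iff minus_le_iff)
      also have "\<dots> \<longleftrightarrow> \<bar>x\<bar> \<le> 1" using assms by (simp add: abs_mult)
      also have "\<dots> \<longleftrightarrow> x \<in> {-1..1}" by (auto simp: abs_le_iff minus_le_iff)
      finally show ?thesis .
    qed
    ultimately show "?f (0 + r * x) = r ^ n * (indicator {-1..1} x * (cos (s * r * x) * sqrt (1 - x\<^sup>2) ^ n))"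
      by (auto simp: indicator_def power_mult_distrib mult_ac)
  qed
  moreover have "has_bochner_integral lborel (\<lambda>x. r ^ n * (indicator {-1..1} x * (cos (s * r * x) * sqrt (1 - x\<^sup>2) ^ n)))
     (r ^ n * ?v)"
    by (intro has_bochner_integral_mult_right has_bochner_integral_cos_weight)
  moreover have "(r ^ (n + 1) * ?v) /\<^sub>R \<bar>r\<bar> = r ^ n * ?v"
    using assms by simp
  ultimately have "has_bochner_integral lborel (\<lambda>x. ?f (0 + r * x)) ((r ^ (n + 1) * ?v) /\<^sub>R \<bar>r\<bar>)"
    by (simp only:)
  then show ?thesis
    using assms by (subst lborel_has_bochner_integral_real_affine_iff[of r _ _ 0]) simp_all
qed

text \<open>Tonelli over the hyperplanes \<open>x i = y\<close>: each slice is a ball of dimension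
  \<open>card I - 1\<close> and radius \<open>sqrt (r\<^sup>2 - y\<^sup>2)\<close>. The summand 1
  together with \<open>\<bar>a\<bar> \<le> 1\<close> keeps the integrand nonnegative, and
  \<open>F \<ge> 0\<close> is recorded because \<open>ennreal\<close> sends negative numbers to
  0.\<close>

lemma nn_integral_ball_cos:
  fixes a r s :: real
  assumes "finite I" "i \<in> I" "r > 0" "\<bar>a\<bar> \<le> 1"
  defines "F \<equiv> pi powr (real (card I) / 2) *
           (r ^ card I * bessel_kernel (card I + 2) 0 + a * (r ^ card I * bessel_kernel (card I + 2) (s * r)))"
  shows "(\<integral>\<^sup>+x. ennreal (1 + a * cos (s * x i)) * indicator {x. sqrt (\<Sum>j\<in>I. (x j)\<^sup>2) \<le> r} x
             \<partial>Pi\<^sub>M I (\<lambda>_. lborel)) = ennreal F"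
    and "F \<ge> 0"
proof -
  define A where "A = I - {i}"
  define n where "n = card A"
  have I: "I = insert i A" "i \<notin> A" "finite A" and card: "card I = n + 1"
    using assms card_Suc_Diff1[of I i] by (auto simp: A_def n_def)
  interpret product_sigma_finite "\<lambda>_. lborel"
    by standard
  have nn: "1 + a * cos y \<ge> 0" for y
  proof -
    have "\<bar>a * cos y\<bar> \<le> 1 * 1" unfolding abs_mult by (intro mult_mono assms abs_cos_le_one) auto
    then show ?thesis by linarith
  qed
  have FN: "(\<integral>\<^sup>+y. ennreal (unit_ball_vol (real n) * (indicator {-r..r} y * (1 * sqrt (r\<^sup>2 - y\<^sup>2) ^ n) +
          a * (indicator {-r..r} y * (cos (s * y) * sqrt (r\<^sup>2 - y\<^sup>2) ^ n)))) \<partial>lborel) = ennreal F"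
    "F \<ge> 0"
  proof -
    \<comment> \<open>Writing the constant 1 as \<open>cos (0 * y)\<close> lets the slice formula
      cover both terms.\<close>
    define B where "B y = unit_ball_vol (real n) * (indicator {-r..r} y * (cos (0 * y) * sqrt (r\<^sup>2 - y\<^sup>2) ^ n) +
          a * (indicator {-r..r} y * (cos (s * y) * sqrt (r\<^sup>2 - y\<^sup>2) ^ n)))" for y
    have "has_bochner_integral lborel B
     (unit_ball_vol (real n) *
      (r ^ (n + 1) * (pi powr (real (n + 1) / 2) * bessel_kernel (n + 3) (0 * r) / unit_ball_vol (real n)) +
       a * (r ^ (n + 1) * (pi powr (real (n + 1) / 2) * bessel_kernel (n + 3) (s * r) / unit_ball_vol (real n)))))"
      unfolding B_def
      by (intro has_bochner_integral_mult_right has_bochner_integral_add has_bochner_integral_cos_slice assms)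
    also have "unit_ball_vol (real n) *
      (r ^ (n + 1) * (pi powr (real (n + 1) / 2) * bessel_kernel (n + 3) (0 * r) / unit_ball_vol (real n)) +
       a * (r ^ (n + 1) * (pi powr (real (n + 1) / 2) * bessel_kernel (n + 3) (s * r) / unit_ball_vol (real n)))) = F"
    proof -
      have "unit_ball_vol (real n) \<noteq> 0"
        using unit_ball_vol_pos[of "real n"] by linarith
      moreover have "card I + 2 = n + 3" using card by simp
      ultimately show ?thesis unfolding F_def card
        by (simp add: field_simps numeral_3_eq_3)
    qed
    finally have B: "has_bochner_integral lborel B F" .
    have B0: "B y \<ge> 0" for y
    proof (cases "y \<in> {-r..r}")
      case True
      then have "\<bar>y\<bar> \<le> r" by auto
      then have "y\<^sup>2 \<le> r\<^sup>2" using assms by (simp add: power2_le_iff_abs_le)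
      then have "unit_ball_vol (real n) * ((1 + a * cos (s * y)) * sqrt (r\<^sup>2 - y\<^sup>2) ^ n) \<ge> 0"
        using nn[of "s * y"] by (intro mult_nonneg_nonneg zero_le_power) auto
      then show ?thesis using True by (simp add: B_def algebra_simps)
    qed (auto simp: B_def)
    have "(\<integral>\<^sup>+y. ennreal (B y) \<partial>lborel) = ennreal F"
      using B B0 by (subst nn_integral_eq_integral) (auto simp: has_bochner_integral_iff)
    then show "(\<integral>\<^sup>+y. ennreal (unit_ball_vol (real n) * (indicator {-r..r} y * (1 * sqrt (r\<^sup>2 - y\<^sup>2) ^ n) +
          a * (indicator {-r..r} y * (cos (s * y) * sqrt (r\<^sup>2 - y\<^sup>2) ^ n)))) \<partial>lborel) = ennreal F"
      by (simp add: B_def)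
    show "F \<ge> 0"
      unfolding has_bochner_integral_integral_eq[OF B, symmetric]
      using B0 by (intro Bochner_Integration.integral_nonneg) auto
  qed
  have "(\<integral>\<^sup>+x. ennreal (1 + a * cos (s * x i)) * indicator {x. sqrt (\<Sum>j\<in>I. (x j)\<^sup>2) \<le> r} x \<partial>Pi\<^sub>M I (\<lambda>_. lborel))
     = (\<integral>\<^sup>+y. \<integral>\<^sup>+x. ennreal (1 + a * cos (s * (x(i := y)) i)) * indicator {x. sqrt (\<Sum>j\<in>insert i A. (x j)\<^sup>2) \<le> r} (x(i := y)) \<partial>Pi\<^sub>M A (\<lambda>_. lborel) \<partial>lborel)"
    unfolding I(1) using I by (subst product_nn_integral_insert_rev) auto
  also have "\<dots> = (\<integral>\<^sup>+y. \<integral>\<^sup>+x. ennreal (1 + a * cos (s * y)) * indicator {-r..r} y *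
      indicator ({x. sqrt (\<Sum>j\<in>A. (x j)\<^sup>2) \<le> sqrt (r\<^sup>2 - y\<^sup>2)} \<inter> space (Pi\<^sub>M A (\<lambda>_. lborel))) x \<partial>Pi\<^sub>M A (\<lambda>_. lborel) \<partial>lborel)"
  proof (intro nn_integral_cong)
    fix y :: real and f :: "'a \<Rightarrow> real" assume f: "f \<in> space (Pi\<^sub>M A (\<lambda>_. lborel))"
    have *: "y \<in> {-r..r}" if "y ^ 2 + c \<le> r ^ 2" "c \<ge> 0" for c
    proof -
      have "y ^ 2 \<le> y ^ 2 + c" using that by simp
      also have "\<dots> \<le> r ^ 2" by fact
      finally show ?thesis
        using \<open>r > 0\<close> by (simp add: power2_le_iff_abs_le abs_if split: if_splits)
    qed
    have "(\<Sum>x\<in>A. (if x = i then y else f x)\<^sup>2) = (\<Sum>x\<in>A. (f x)\<^sup>2)"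
      using I by (intro sum.cong) auto
    then show "ennreal (1 + a * cos (s * (f(i := y)) i)) * indicator {x. sqrt (\<Sum>j\<in>insert i A. (x j)\<^sup>2) \<le> r} (f(i := y)) =
      ennreal (1 + a * cos (s * y)) * indicator {-r..r} y *
      indicator ({x. sqrt (\<Sum>j\<in>A. (x j)\<^sup>2) \<le> sqrt (r\<^sup>2 - y\<^sup>2)} \<inter> space (Pi\<^sub>M A (\<lambda>_. lborel))) f"
      using f \<open>r > 0\<close> I *[of "\<Sum>x\<in>A. (f x)\<^sup>2"]
      by (cases "y \<in> {-r..r}") (auto simp: sum_nonneg real_sqrt_le_iff' indicator_def)
  qed
  also have "\<dots> = (\<integral>\<^sup>+y. ennreal (1 + a * cos (s * y)) * indicator {-r..r} y * emeasure (Pi\<^sub>M A (\<lambda>_. lborel))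
      ({x. sqrt (\<Sum>j\<in>A. (x j)\<^sup>2) \<le> sqrt (r\<^sup>2 - y\<^sup>2)} \<inter> space (Pi\<^sub>M A (\<lambda>_. lborel))) \<partial>lborel)"
    by (intro nn_integral_cong, subst nn_integral_cmult_indicator) (auto simp: I)
  also have "\<dots> = (\<integral>\<^sup>+y. ennreal (unit_ball_vol (real n) * (indicator {-r..r} y * (1 * sqrt (r\<^sup>2 - y\<^sup>2) ^ n) +
          a * (indicator {-r..r} y * (cos (s * y) * sqrt (r\<^sup>2 - y\<^sup>2) ^ n)))) \<partial>lborel)"
  proof (intro nn_integral_cong_AE)
    \<comment> \<open>At \<open>y = r\<close> and \<open>y = -r\<close> the slice degenerates; the
      volume formula is applied to positive radii only.\<close>
    have "AE y in lborel. y \<notin> {-r,r}"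
      by (intro AE_not_in countable_imp_null_set_lborel) auto
    then show "AE y in lborel. ennreal (1 + a * cos (s * y)) * indicator {-r..r} y * emeasure (Pi\<^sub>M A (\<lambda>_. lborel))
      ({x. sqrt (\<Sum>j\<in>A. (x j)\<^sup>2) \<le> sqrt (r\<^sup>2 - y\<^sup>2)} \<inter> space (Pi\<^sub>M A (\<lambda>_. lborel))) =
        ennreal (unit_ball_vol (real n) * (indicator {-r..r} y * (1 * sqrt (r\<^sup>2 - y\<^sup>2) ^ n) +
          a * (indicator {-r..r} y * (cos (s * y) * sqrt (r\<^sup>2 - y\<^sup>2) ^ n))))"
    proof eventually_elim
      case (elim y)
      show ?case
      proof (cases "y \<in> {-r<..<r}")
        case True
        hence "y\<^sup>2 < r\<^sup>2" by (subst real_sqrt_less_iff [symmetric]) auto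
        then have "emeasure (Pi\<^sub>M A (\<lambda>_. lborel))
          ({x. sqrt (\<Sum>j\<in>A. (x j)\<^sup>2) \<le> sqrt (r\<^sup>2 - y\<^sup>2)} \<inter> space (Pi\<^sub>M A (\<lambda>_. lborel))) =
           ennreal (unit_ball_vol (real n) * sqrt (r\<^sup>2 - y\<^sup>2) ^ n)"
          unfolding n_def by (intro emeasure_cball_aux I) auto
        then show ?thesis using True nn[of "s * y"]
          by (auto simp: algebra_simps simp flip: ennreal_mult')
      qed (insert elim, auto)
    qed
  qed
  also note FN(1)
  finally show "(\<integral>\<^sup>+x. ennreal (1 + a * cos (s * x i)) * indicator {x. sqrt (\<Sum>j\<in>I. (x j)\<^sup>2) \<le> r} x
             \<partial>Pi\<^sub>M I (\<lambda>_. lborel)) = ennreal F" .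
  show "F \<ge> 0" by (rule FN(2))
qed

text \<open>
  The integral of \<open>1 \<plusminus> cos (x z\<^sub>0)\<close> over a ball increases with the radius; its derivative in the
  radius is nonnegative.
\<close>

lemma abs_bessel_kernel_le:
  assumes "m \<ge> 1"
  shows "\<bar>bessel_kernel m x\<bar> \<le> bessel_kernel m 0"
proof -
  have *: "bessel_kernel m 0 + a * bessel_kernel m x \<ge> 0" if a: "\<bar>a\<bar> \<le> 1" for a
  proof -
    define F where "F r = r ^ m * bessel_kernel (m + 2) 0 + a * (r ^ m * bessel_kernel (m + 2) (x * r))" for r
    have F: "ennreal (pi powr (real m / 2) * F r) = (\<integral>\<^sup>+z. ennreal (1 + a * cos (x * z 0)) * indicator {z. sqrt (\<Sum>j<m. (z j)\<^sup>2) \<le> r} z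
             \<partial>Pi\<^sub>M {..<m} (\<lambda>_. lborel))" if "r > 0" for r
      using nn_integral_ball_cos(1)[of "{..<m}" 0 r a x] assms a that by (simp add: F_def)
    have "mono_on {0<..} F"
    proof (rule mono_onI)
      fix r r' :: real assume r: "r \<in> {0<..}" "r' \<in> {0<..}" "r \<le> r'"
      have "ennreal (pi powr (real m / 2) * F r) \<le> ennreal (pi powr (real m / 2) * F r')"
        using r by (auto simp: F indicator_def intro!: nn_integral_mono)
      moreover have "pi powr (real m / 2) * F r' \<ge> 0"
        using nn_integral_ball_cos(2)[of "{..<m}" 0 r' a x] assms a r by (simp add: F_def)
      ultimately show "F r \<le> F r'" by (simp add: ennreal_le_iff)
    qed
    moreover have "(F has_real_derivative (2 * 1 ^ (m - 1) * bessel_kernel m (0 * 1) + a * (2 * 1 ^ (m - 1) * bessel_kernel m (x * 1)))) (at 1)"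
    proof -
      have "((\<lambda>r. r ^ m * bessel_kernel (m + 2) (0 * r) + a * (r ^ m * bessel_kernel (m + 2) (x * r))) has_real_derivative
        (2 * 1 ^ (m - 1) * bessel_kernel m (0 * 1) + a * (2 * 1 ^ (m - 1) * bessel_kernel m (x * 1)))) (at 1)"
        by (intro DERIV_add DERIV_cmult ball_kernel_deriv assms)
      then show ?thesis unfolding F_def[abs_def] by simp
    qed
    ultimately have "2 * 1 ^ (m - 1) * bessel_kernel m (0 * 1) + a * (2 * 1 ^ (m - 1) * bessel_kernel m (x * 1)) \<ge> 0"
      by (rule mono_on_imp_deriv_nonneg) (simp add: interior_open)
    then show ?thesis by simp
  qed
  from *[of 1] *[of "-1"] show ?thesis by simp
qed

text \<open>
  Polar coordinates for the weight \<open>cos (s x\<^sub>i)\<close>. Adding the constant 1 makes the density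
  nonnegative, so that both sides are measures and agree as soon as they agree on balls.
\<close>

lemma distr_norm_density_cos:
  assumes "finite I" "i \<in> I"
  defines "m \<equiv> card I"
  shows "distr (density (Pi\<^sub>M I (\<lambda>_. lborel)) (\<lambda>x. ennreal (1 + cos (s * x i)))) borel (\<lambda>x. L2_set x I) =
     density lborel (\<lambda>u. ennreal (2 * pi powr (real m / 2) * u ^ (m - 1) *
        (bessel_kernel m 0 + bessel_kernel m (s * u))) * indicator {0..} u)"
    (is "?N1 = ?N2")
proof (rule measure_eqI_generator_eq[where E = "range (\<lambda>a. {..a::real})" and \<Omega> = UNIV and A = "\<lambda>n. {..real n}"])
  have m: "m \<ge> 1" using assms card_gt_0_iff[of I] by auto
  define F where "F r = pi powr (real m / 2) * (r ^ m * bessel_kernel (m + 2) 0 + 1 * (r ^ m * bessel_kernel (m + 2) (s * r)))" for r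
  define F' where "F' u = 2 * pi powr (real m / 2) * u ^ (m - 1) * (bessel_kernel m 0 + bessel_kernel m (s * u))" for u
  have F0: "F 0 = 0" using m by (simp add: F_def)
  have DF: "(F has_real_derivative F' r) (at r)" for r
  proof -
    have "((\<lambda>r. pi powr (real m / 2) * (r ^ m * bessel_kernel (m + 2) (0 * r) + 1 * (r ^ m * bessel_kernel (m + 2) (s * r)))) has_real_derivative
        (pi powr (real m / 2) * (2 * r ^ (m - 1) * bessel_kernel m (0 * r) + 1 * (2 * r ^ (m - 1) * bessel_kernel m (s * r))))) (at r)"
      by (intro DERIV_add DERIV_cmult ball_kernel_deriv m)
    then show ?thesis unfolding F_def[abs_def] F'_def by (simp add: algebra_simps)
  qed
  have F'_nonneg: "F' u \<ge> 0" if "u \<ge> 0" for u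
    using abs_bessel_kernel_le[OF m, of "s * u"] that by (auto simp: F'_def intro!: mult_nonneg_nonneg)
  have F'_meas[measurable]: "F' \<in> borel_measurable borel"
    using m unfolding F'_def[abs_def] by (intro borel_measurable_continuous_onI continuous_intros) auto
  have N1: "emeasure ?N1 {..r} = (\<integral>\<^sup>+x. ennreal (1 + 1 * cos (s * x i)) * indicator {x. sqrt (\<Sum>j\<in>I. (x j)\<^sup>2) \<le> r} x \<partial>Pi\<^sub>M I (\<lambda>_. lborel))" for r
    using assms by (subst emeasure_distr, simp add: L2_set_def, simp, subst emeasure_density)
       (auto simp: L2_set_def indicator_def intro!: nn_integral_cong)
  have N1_pos: "emeasure ?N1 {..r} = ennreal (F r)" "F r \<ge> 0" if "r > 0" for r
    unfolding N1 F_def m_def using nn_integral_ball_cos[of I i r 1 s] assms that by auto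
  \<comment> \<open>The ball formula assumes a positive radius. For \<open>r \<le> 0\<close> the
    mass is bounded by \<open>F q\<close> for every \<open>q > 0\<close>, and \<open>F q\<close>
    tends to \<open>F 0 = 0\<close>.\<close>
  have N1_0: "emeasure ?N1 {..r} = 0" if "r \<le> 0" for r
  proof -
    have "(\<lambda>r. ennreal (F r)) \<midarrow>0\<rightarrow> ennreal (F 0)"
      using DF[of 0] by (intro tendsto_ennrealI isContD DERIV_isCont)
    then have "((\<lambda>r. ennreal (F r)) \<longlongrightarrow> ennreal (F 0)) (at_right 0)"
      by (rule tendsto_mono[rotated]) (simp add: at_le)
    moreover have "eventually (\<lambda>q. emeasure ?N1 {..r} \<le> ennreal (F q)) (at_right 0)"
      using eventually_at_right_less[of 0]
    proof eventually_elim
      case (elim q)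
      have "emeasure ?N1 {..r} \<le> emeasure ?N1 {..q}" using that elim by (intro emeasure_mono) auto
      then show ?case using N1_pos[of q] elim by simp
    qed
    ultimately have "emeasure ?N1 {..r} \<le> ennreal (F 0)"
      by (intro tendsto_lowerbound) auto
    then show ?thesis using F0 by simp
  qed
  have N2: "emeasure ?N2 {..r} = (\<integral>\<^sup>+u. ennreal (F' u) * indicator {0..r} u \<partial>lborel)" for r
    unfolding F'_def[symmetric]
    by (subst emeasure_density) (auto simp: indicator_def intro!: nn_integral_cong)
  have N2_pos: "emeasure ?N2 {..r} = ennreal (F r)" if "r \<ge> 0" for r
    unfolding N2 using that F0
    by (subst nn_integral_FTC_Icc[where F = F]) (auto intro: DERIV_subset[OF DF] F'_nonneg has_field_derivative_at_within DF)
  have N2_0: "emeasure ?N2 {..r} = 0" if "r \<le> 0" for r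
  proof (cases "r = 0")
    case True then show ?thesis using N2_pos[of 0] F0 by simp
  next
    case False then show ?thesis unfolding N2 using that by simp
  qed
  show "emeasure ?N1 X = emeasure ?N2 X" if "X \<in> range (\<lambda>a. {..a::real})" for X
  proof -
    obtain r where "X = {..r}" using \<open>X \<in> _\<close> by auto
    then show ?thesis using N1_pos[of r] N1_0[of r] N2_pos[of r] N2_0[of r] by (cases "r \<le> 0") auto
  qed
  show "emeasure ?N1 {..real n} \<noteq> \<infinity>" for n
    using N1_pos[of "real n"] N1_0[of "real n"] by (cases "n = 0") auto
  show "Int_stable (range (\<lambda>a. {..a::real}))"
    by (auto simp: Int_stable_def)
  show "(\<Union>i. {..real i}) = UNIV"
    using real_arch_simple by auto
  show "sets ?N1 = sigma_sets UNIV (range (\<lambda>a. {..a::real}))"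
    "sets ?N2 = sigma_sets UNIV (range (\<lambda>a. {..a::real}))"
    by (simp_all add: borel_eq_atMost)
qed auto

text \<open>Integrate \<open>f\<close> against the two equal measures of
  \<open>distr_norm_density_cos\<close>. The case \<open>s = 0\<close>, where the weight is 2, gives
  the integral without the cosine, and subtracting that integral removes the auxiliary constant
  1.\<close>

lemma radial_integral_cos:
  fixes f :: "real \<Rightarrow> real"
  assumes "finite I" "i \<in> I"
  defines "m \<equiv> card I"
  assumes f[measurable]: "f \<in> borel_measurable borel"
    and int: "integrable lborel (\<lambda>u. indicator {0..} u * (u ^ (m - 1) * f u))"
  shows "integrable (Pi\<^sub>M I (\<lambda>_. lborel)) (\<lambda>x. f (L2_set x I))"
    and "(\<integral>x. cos (s * x i) * f (L2_set x I) \<partial>Pi\<^sub>M I (\<lambda>_. lborel)) =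
       2 * pi powr (real m / 2) * (\<integral>u. indicator {0..} u * (u ^ (m - 1) * bessel_kernel m (s * u) * f u) \<partial>lborel)"
    and "integrable lborel (\<lambda>u. indicator {0..} u * (u ^ (m - 1) * bessel_kernel m (s * u) * f u))"
proof -
  have m: "m \<ge> 1" using assms card_gt_0_iff[of I] by auto
  note [measurable] = borel_measurable_bessel_kernel[OF m]
  define P where "P = pi powr (real m / 2)"
  have P: "P > 0" by (simp add: P_def)
  define k where "k s u = 2 * P * u ^ (m - 1) * (bessel_kernel m 0 + bessel_kernel m (s * u)) * indicator {0..} u" for s u
  have k_nonneg: "k s u \<ge> 0" for s u
    using abs_bessel_kernel_le[OF m, of "s * u"] P
    by (auto simp: k_def indicator_def intro!: mult_nonneg_nonneg)
  have [measurable]: "k s \<in> borel_measurable borel" for s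
    unfolding k_def[abs_def] by measurable
  have bi: "integrable lborel (\<lambda>u. indicator {0..} u * (u ^ (m - 1) * bessel_kernel m (s * u) * f u))" for s
  proof (rule Bochner_Integration.integrable_bound)
    show "integrable lborel (\<lambda>u. bessel_kernel m 0 * (indicator {0..} u * (u ^ (m - 1) * f u)))"
      using int by (rule integrable_mult_right)
    show "AE u in lborel. norm (indicator {0..} u * (u ^ (m - 1) * bessel_kernel m (s * u) * f u))
        \<le> norm (bessel_kernel m 0 * (indicator {0..} u * (u ^ (m - 1) * f u)))"
    proof (rule AE_I2)
      fix u
      have "\<bar>bessel_kernel m (s * u)\<bar> * \<bar>indicator {0..} u * (u ^ (m - 1) * f u)\<bar>
         \<le> \<bar>bessel_kernel m 0\<bar> * \<bar>indicator {0..} u * (u ^ (m - 1) * f u)\<bar>"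
        using abs_bessel_kernel_le[OF m, of "s * u"] by (intro mult_right_mono) auto
      then show "norm (indicator {0..} u * (u ^ (m - 1) * bessel_kernel m (s * u) * f u))
        \<le> norm (bessel_kernel m 0 * (indicator {0..} u * (u ^ (m - 1) * f u)))"
        by (simp add: abs_mult mult_ac)
    qed
  qed measurable
  then show "integrable lborel (\<lambda>u. indicator {0..} u * (u ^ (m - 1) * bessel_kernel m (s * u) * f u))" .
  have kf: "k s u * f u = 2 * P * (indicator {0..} u * (u ^ (m - 1) * bessel_kernel m (0 * u) * f u))
      + 2 * P * (indicator {0..} u * (u ^ (m - 1) * bessel_kernel m (s * u) * f u))" for s u
    by (simp add: k_def algebra_simps)
  have ki: "integrable lborel (\<lambda>u. k s u * f u)" for s
    unfolding kf by (intro Bochner_Integration.integrable_add integrable_mult_right bi)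
  have kI: "(\<integral>u. k s u * f u \<partial>lborel) = 
      2 * P * (\<integral>u. indicator {0..} u * (u ^ (m - 1) * bessel_kernel m (0 * u) * f u) \<partial>lborel)
      + 2 * P * (\<integral>u. indicator {0..} u * (u ^ (m - 1) * bessel_kernel m (s * u) * f u) \<partial>lborel)" for s
    unfolding kf
    by (subst Bochner_Integration.integral_add)
       (intro integrable_mult_right bi, intro integrable_mult_right bi, simp only: integral_mult_right_zero)
  have eq: "distr (density (Pi\<^sub>M I (\<lambda>_. lborel)) (\<lambda>x. ennreal (1 + cos (s * x i)))) borel (\<lambda>x. L2_set x I) =
     density lborel (\<lambda>u. ennreal (k s u))" for s
  proof -
    have "ennreal (2 * pi powr (real m / 2) * u ^ (m - 1) *
        (bessel_kernel m 0 + bessel_kernel m (s * u))) * indicator {0..} u = ennreal (k s u)" for u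
      by (auto simp: k_def P_def indicator_def)
    then show ?thesis using distr_norm_density_cos[OF assms(1,2), of s] by (simp add: m_def)
  qed
  have [measurable]: "(\<lambda>x. L2_set x I) \<in> borel_measurable (Pi\<^sub>M I (\<lambda>_. lborel))"
    unfolding L2_set_def by measurable
  have [measurable]: "(\<lambda>x. x i) \<in> borel_measurable (Pi\<^sub>M I (\<lambda>_. lborel))"
    using assms by measurable
  have c: "0 \<le> 1 + cos x" for x :: real
    using cos_ge_minus_one[of x] by linarith
  have A: "integrable (Pi\<^sub>M I (\<lambda>_. lborel)) (\<lambda>x. (1 + cos (s * x i)) * f (L2_set x I))" for s
  proof -
    have "integrable (density lborel (\<lambda>u. ennreal (k s u))) f"
      using ki[of s] k_nonneg by (subst integrable_density) auto
    then have "integrable (density (Pi\<^sub>M I (\<lambda>_. lborel)) (\<lambda>x. ennreal (1 + cos (s * x i)))) (\<lambda>x. f (L2_set x I))"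
      unfolding eq[symmetric] by (subst (asm) integrable_distr_eq) auto
    then show ?thesis
      using c by (subst (asm) integrable_density) auto
  qed
  have B: "(\<integral>x. (1 + cos (s * x i)) * f (L2_set x I) \<partial>Pi\<^sub>M I (\<lambda>_. lborel)) = (\<integral>u. k s u * f u \<partial>lborel)" for s
  proof -
    have "(\<integral>u. k s u * f u \<partial>lborel) = integral\<^sup>L (density lborel (\<lambda>u. ennreal (k s u))) f"
      using k_nonneg by (subst integral_density) auto
    also have "\<dots> = (\<integral>x. f (L2_set x I) \<partial>density (Pi\<^sub>M I (\<lambda>_. lborel)) (\<lambda>x. ennreal (1 + cos (s * x i))))"
      unfolding eq[symmetric] by (subst integral_distr) auto
    also have "\<dots> = (\<integral>x. (1 + cos (s * x i)) * f (L2_set x I) \<partial>Pi\<^sub>M I (\<lambda>_. lborel))"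
      using c by (subst integral_density) auto
    finally show ?thesis ..
  qed
  have "integrable (Pi\<^sub>M I (\<lambda>_. lborel)) (\<lambda>x. 1/2 * ((1 + cos (0 * x i)) * f (L2_set x I)))"
    by (intro integrable_mult_right A)
  then show C: "integrable (Pi\<^sub>M I (\<lambda>_. lborel)) (\<lambda>x. f (L2_set x I))" by simp
  have "(\<integral>x. f (L2_set x I) \<partial>Pi\<^sub>M I (\<lambda>_. lborel)) = 2 * P * (\<integral>u. indicator {0..} u * (u ^ (m - 1) * bessel_kernel m (0 * u) * f u) \<partial>lborel)"
    using B[of 0] unfolding kI by simp
  moreover have "(\<integral>x. cos (s * x i) * f (L2_set x I) \<partial>Pi\<^sub>M I (\<lambda>_. lborel)) = 
      (\<integral>x. (1 + cos (s * x i)) * f (L2_set x I) \<partial>Pi\<^sub>M I (\<lambda>_. lborel)) - (\<integral>x. f (L2_set x I) \<partial>Pi\<^sub>M I (\<lambda>_. lborel))"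
    by (subst Bochner_Integration.integral_diff[symmetric], rule A, rule C) (simp add: algebra_simps)
  ultimately show "(\<integral>x. cos (s * x i) * f (L2_set x I) \<partial>Pi\<^sub>M I (\<lambda>_. lborel)) =
       2 * pi powr (real m / 2) * (\<integral>u. indicator {0..} u * (u ^ (m - 1) * bessel_kernel m (s * u) * f u) \<partial>lborel)"
    using B[of s] unfolding kI P_def by simp
qed

section \<open>Integrals of positive definite kernels\<close>

text \<open>Distinct coordinates of an independent sample are independent: the preimage of a
  rectangle is a box whose other factors are \<open>space M\<close>, of mass 1.\<close>

lemma distr_PiM_two_coordinates:
  assumes "prob_space M" "p < N" "q < N" "p \<noteq> q"
  shows "distr (Pi\<^sub>M {..<N::nat} (\<lambda>_. M)) (M \<Otimes>\<^sub>M M) (\<lambda>x. (x p, x q)) = M \<Otimes>\<^sub>M M"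
proof -
  interpret prob_space M by fact
  interpret product_prob_space "\<lambda>_. M" "{..<N}" by standard
  have "M \<Otimes>\<^sub>M M = distr (Pi\<^sub>M {..<N} (\<lambda>_. M)) (M \<Otimes>\<^sub>M M) (\<lambda>x. (x p, x q))"
  proof (rule pair_measure_eqI)
    fix A B assume AB: "A \<in> sets M" "B \<in> sets M"
    define X where "X i = (if i = p then A else if i = q then B else space M)" for i
    have X: "X i \<in> sets M" for i using AB by (auto simp: X_def)
    have "(\<lambda>x. (x p, x q)) -` (A \<times> B) \<inter> space (Pi\<^sub>M {..<N} (\<lambda>_. M)) = Pi\<^sub>E {..<N} X"
    proof (intro set_eqI iffI)
      fix x assume "x \<in> (\<lambda>x. (x p, x q)) -` (A \<times> B) \<inter> space (Pi\<^sub>M {..<N} (\<lambda>_. M))"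
      then show "x \<in> Pi\<^sub>E {..<N} X"
        using assms by (auto simp: space_PiM PiE_iff X_def)
    next
      fix x assume x: "x \<in> Pi\<^sub>E {..<N} X"
      then have "x i \<in> space M" if "i < N" for i
        using that X[THEN sets.sets_into_space] by (auto simp: PiE_iff)
      moreover have "x p \<in> X p" "x q \<in> X q" using x assms by (auto simp: PiE_iff)
      ultimately show "x \<in> (\<lambda>x. (x p, x q)) -` (A \<times> B) \<inter> space (Pi\<^sub>M {..<N} (\<lambda>_. M))"
        using x assms by (auto simp: space_PiM PiE_iff X_def)
    qed
    then have "emeasure (distr (Pi\<^sub>M {..<N} (\<lambda>_. M)) (M \<Otimes>\<^sub>M M) (\<lambda>x. (x p, x q))) (A \<times> B)
        = emeasure (Pi\<^sub>M {..<N} (\<lambda>_. M)) (Pi\<^sub>E {..<N} X)"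
      using assms AB by (subst emeasure_distr) auto
    also have "\<dots> = (\<Prod>i<N. emeasure M (X i))"
      using X by (intro emeasure_PiM) auto
    also have "\<dots> = (\<Prod>i\<in>{p, q}. emeasure M (X i))"
      using assms by (intro prod.mono_neutral_right) (auto simp: X_def prob_space.emeasure_space_1[OF assms(1)])
    also have "\<dots> = emeasure M A * emeasure M B"
      using assms by (auto simp: X_def)
    finally show "emeasure M A * emeasure M B =
      emeasure (distr (Pi\<^sub>M {..<N} (\<lambda>_. M)) (M \<Otimes>\<^sub>M M) (\<lambda>x. (x p, x q))) (A \<times> B)" ..
  qed (auto intro: prob_space_imp_sigma_finite[OF assms(1)])
  then show ?thesis ..
qed

text \<open>
  Average the double sum over \<open>N\<close> independent samples of \<open>M\<close>: the \<open>N(N - 1)\<close> off-diagonal terms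
  contribute the double integral each, the diagonal only \<open>O(N)\<close>.
\<close>

lemma double_integral_pos_def_nonneg:
  fixes H :: "'a \<times> 'a \<Rightarrow> real"
  assumes "prob_space M" and H[measurable]: "H \<in> borel_measurable (M \<Otimes>\<^sub>M M)"
    and bound: "\<And>z. \<bar>H z\<bar> \<le> C"
    and pd: "\<And>(N::nat) x. (\<And>p. p < N \<Longrightarrow> x p \<in> space M) \<Longrightarrow> 0 \<le> (\<Sum>p<N. \<Sum>q<N. H (x p, x q))"
  shows "0 \<le> (\<integral>z. H z \<partial>(M \<Otimes>\<^sub>M M))"
proof -
  interpret prob_space M by fact
  define J where "J = (\<integral>z. H z \<partial>(M \<Otimes>\<^sub>M M))"
  have *: "0 \<le> C + (real N - 1) * J" if "N > 0" for N :: nat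
  proof -
    define Q where "Q = Pi\<^sub>M {..<N} (\<lambda>_. M)"
    interpret product_prob_space "\<lambda>_. M" "{..<N}" by standard
    interpret Q: prob_space Q unfolding Q_def by (rule prob_space_PiM) (rule assms)
    have [measurable]: "(\<lambda>x. H (x p, x q)) \<in> borel_measurable Q" if "p < N" "q < N" for p q
      using that unfolding Q_def
      by (intro measurable_compose[OF measurable_Pair H] measurable_component_singleton) auto
    have int: "integrable Q (\<lambda>x. H (x p, x q))" if "p < N" "q < N" for p q
      by (rule Q.integrable_const_bound[of _ C]) (use that bound in auto)
    have le: "(\<integral>x. H (x p, x q) \<partial>Q) \<le> (if p = q then C else J)" if "p < N" "q < N" for p q
    proof (cases "p = q")
      case True
      have "(\<integral>x. H (x p, x q) \<partial>Q) \<le> (\<integral>x. C \<partial>Q)"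
        using bound int[OF that] by (intro integral_mono) (auto simp: abs_le_iff)
      then show ?thesis using True by (simp add: Q.prob_space)
    next
      case False
      have "J = integral\<^sup>L (distr Q (M \<Otimes>\<^sub>M M) (\<lambda>x. (x p, x q))) H"
        unfolding Q_def J_def distr_PiM_two_coordinates[OF assms(1) that False] ..
      also have "\<dots> = (\<integral>x. H (x p, x q) \<partial>Q)"
        using that by (subst integral_distr) (auto simp: Q_def)
      finally show ?thesis using False by simp
    qed
    have "0 \<le> (\<integral>x. (\<Sum>p<N. \<Sum>q<N. H (x p, x q)) \<partial>Q)"
    proof (rule Bochner_Integration.integral_nonneg)
      fix x assume "x \<in> space Q"
      then show "0 \<le> (\<Sum>p<N. \<Sum>q<N. H (x p, x q))"
        by (intro pd) (auto simp: Q_def space_PiM)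
    qed
    also have "\<dots> = (\<Sum>p<N. \<Sum>q<N. \<integral>x. H (x p, x q) \<partial>Q)"
    proof -
      have "(\<integral>x. (\<Sum>p<N. \<Sum>q<N. H (x p, x q)) \<partial>Q) = (\<Sum>p<N. \<integral>x. (\<Sum>q<N. H (x p, x q)) \<partial>Q)"
        by (intro Bochner_Integration.integral_sum Bochner_Integration.integrable_sum int) auto
      also have "\<dots> = (\<Sum>p<N. \<Sum>q<N. \<integral>x. H (x p, x q) \<partial>Q)"
        by (intro sum.cong refl Bochner_Integration.integral_sum int) auto
      finally show ?thesis .
    qed
    also have "\<dots> \<le> (\<Sum>p<N. \<Sum>q<N. if p = q then C else J)"
      by (intro sum_mono le) auto
    also have "\<dots> = (\<Sum>p<N. \<Sum>q<N. J + (if p = q then C - J else 0))"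
      by (intro sum.cong) auto
    also have "\<dots> = real N * (C + (real N - 1) * J)"
      by (simp add: sum.distrib algebra_simps)
    finally show ?thesis using that by (simp add: zero_le_mult_iff)
  qed
  \<comment> \<open>The bound just proved is affine in \<open>N\<close> with slope \<open>J\<close>,
    so a negative \<open>J\<close> would violate it for large \<open>N\<close>.\<close>
  show ?thesis
  proof (rule ccontr)
    assume "\<not> ?thesis"
    then have "J < 0" by (simp add: J_def)
    then obtain N :: nat where "C / (- J) < real N" using reals_Archimedean2 by blast
    then have "C + real N * J < 0" using \<open>J < 0\<close> by (simp add: field_simps)
    moreover have "0 \<le> C + (real (Suc N) - 1) * J" by (rule *) simp
    ultimately show False by simp
  qed
qed

text \<open>Both measures agree on boxes, by translation invariance in each coordinate. The
  restriction to \<open>I\<close> keeps the translated points in the space of extensional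
  functions.\<close>

lemma distr_PiM_lborel_plus:
  fixes y :: "'i \<Rightarrow> real"
  assumes "finite I"
  defines "L \<equiv> Pi\<^sub>M I (\<lambda>_. lborel)"
  shows "distr L L (\<lambda>x. \<lambda>i\<in>I. x i + y i) = L"
  unfolding L_def
proof (rule product_sigma_finite.PiM_eqI)
  show "product_sigma_finite (\<lambda>_. lborel :: real measure)" by standard
  fix A :: "'i \<Rightarrow> real set" assume A: "\<And>i. i \<in> I \<Longrightarrow> A i \<in> sets lborel"
  interpret product_sigma_finite "\<lambda>_. lborel :: real measure" by standard
  define A' where "A' i = (+) (y i) -` A i" for i
  have A': "A' i \<in> sets lborel" "emeasure lborel (A' i) = emeasure lborel (A i)" if "i \<in> I" for i
  proof -
    show "A' i \<in> sets lborel" using A[OF that] measurable_sets[of "(+) (y i)" borel borel "A i"] by (simp add: A'_def)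
    have "emeasure lborel (A i) = emeasure (distr lborel borel ((+) (y i))) (A i)"
      by (simp add: lborel_distr_plus)
    also have "\<dots> = emeasure lborel (A' i)"
      using A[OF that] by (subst emeasure_distr) (auto simp: A'_def)
    finally show "emeasure lborel (A' i) = emeasure lborel (A i)" ..
  qed
  have "(\<lambda>x. \<lambda>i\<in>I. x i + y i) -` Pi\<^sub>E I A \<inter> space (Pi\<^sub>M I (\<lambda>_. lborel)) = Pi\<^sub>E I A'"
    by (auto simp: space_PiM PiE_iff A'_def add.commute)
  then have "emeasure (distr (Pi\<^sub>M I (\<lambda>_. lborel)) (Pi\<^sub>M I (\<lambda>_. lborel)) (\<lambda>x. \<lambda>i\<in>I. x i + y i)) (Pi\<^sub>E I A)
    = emeasure (Pi\<^sub>M I (\<lambda>_. lborel)) (Pi\<^sub>E I A')"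
    using A assms by (subst emeasure_distr) (auto intro!: sets_PiM_I_finite)
  also have "\<dots> = (\<Prod>i\<in>I. emeasure lborel (A i))"
    using A' assms by (subst emeasure_PiM) auto
  finally show "emeasure (distr (Pi\<^sub>M I (\<lambda>_. lborel)) (Pi\<^sub>M I (\<lambda>_. lborel)) (\<lambda>x. \<lambda>i\<in>I. x i + y i)) (Pi\<^sub>E I A)
    = (\<Prod>i\<in>I. emeasure lborel (A i))" .
qed (use assms in auto)

text \<open>
  Apply the previous lemma to the uniform distribution on the cube of side \<open>R\<close>. The difference of two
  independent points has a density proportional to \<open>W R\<close>, and \<open>W R\<close> increases to 1 as \<open>R \<rightarrow> \<infinity>\<close>.
\<close>

lemma pos_def_integral_nonneg:
  fixes H :: "('i \<Rightarrow> real) \<Rightarrow> real"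
  assumes I: "finite I"
  defines "L \<equiv> Pi\<^sub>M I (\<lambda>_. lborel)"
  assumes int: "integrable L H"
    and bound: "\<And>z. \<bar>H z\<bar> \<le> C"
    and pd: "\<And>(N::nat) x. 0 \<le> (\<Sum>p<N. \<Sum>q<N. H (\<lambda>i\<in>I. x p i - x q i))"
  shows "0 \<le> (\<integral>z. H z \<partial>L)"
proof -
  interpret product_sigma_finite "\<lambda>_. lborel :: real measure" by standard
  interpret L: sigma_finite_measure L unfolding L_def using I by (rule sigma_finite)
  interpret LL: pair_sigma_finite L L by standard
  have H[measurable]: "H \<in> borel_measurable L" using int by auto
  have diff[measurable]: "(\<lambda>z. \<lambda>i\<in>I. fst z i - snd z i) \<in> measurable (L \<Otimes>\<^sub>M L) L"
    unfolding L_def by (intro measurable_restrict) measurable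
  have plus[measurable]: "(\<lambda>z. \<lambda>i\<in>I. fst z i + snd z i) \<in> measurable (L \<Otimes>\<^sub>M L) L"
    unfolding L_def by (intro measurable_restrict) measurable
  have plus1[measurable]: "(\<lambda>z. \<lambda>i\<in>I. z i + y i) \<in> measurable L L" for y
    unfolding L_def by (intro measurable_restrict) measurable
  have spL: "space L = Pi\<^sub>E I (\<lambda>_. UNIV)" by (simp add: L_def space_PiM)
  have C: "C \<ge> 0" using bound[of undefined] by linarith
  define W where "W R z = (\<Prod>i\<in>I. max 0 (1 - \<bar>z i\<bar> / R))" for R :: real and z
  have W_meas[measurable]: "W R \<in> borel_measurable L" for R
    unfolding W_def[abs_def] L_def by measurable
  have step: "0 \<le> (\<integral>z. W R z * H z \<partial>L)" if R: "R > 0" for R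
  proof -
    define Q where "Q = Pi\<^sub>E I (\<lambda>_. {0..R})"
    have Q[measurable]: "Q \<in> sets L" unfolding Q_def L_def using I by (intro sets_PiM_I_finite) auto
    have emQ: "emeasure L Q = ennreal (R ^ card I)"
      unfolding Q_def L_def using I R by (subst emeasure_PiM) (auto simp: ennreal_power)
    define M where "M = uniform_measure L Q"
    have M: "prob_space M" unfolding M_def using R
      by (intro prob_space_uniform_measure) (auto simp: emQ)
    have Md: "M = density L (\<lambda>x. ennreal (indicator Q x / R ^ card I))"
      unfolding M_def uniform_measure_def emQ using R
      by (intro density_cong) (auto simp: indicator_def divide_ennreal[of 1, simplified])
    have setsM[measurable_cong]: "sets M = sets L" by (simp add: Md)
    interpret M: prob_space M by fact
    define H' where "H' z = H (\<lambda>i\<in>I. fst z i - snd z i)" for z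
    have [measurable]: "H' \<in> borel_measurable (L \<Otimes>\<^sub>M L)"
      unfolding H'_def by measurable
    define g where "g z = indicator Q (fst z) * indicator Q (snd z) * H' z" for z
    have [measurable]: "g \<in> borel_measurable (L \<Otimes>\<^sub>M L)" unfolding g_def by measurable
    have "0 \<le> (\<integral>z. H' z \<partial>(M \<Otimes>\<^sub>M M))"
    proof (rule double_integral_pos_def_nonneg[OF M, of _ C])
      show "H' \<in> borel_measurable (M \<Otimes>\<^sub>M M)" by measurable
    qed (use bound pd in \<open>auto simp: H'_def\<close>)
    also have "M \<Otimes>\<^sub>M M = density (L \<Otimes>\<^sub>M L) (\<lambda>(x, y). ennreal (indicator Q x / R ^ card I) * ennreal (indicator Q y / R ^ card I))"
      unfolding Md
    proof (rule pair_measure_density)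
      show "sigma_finite_measure (density L (\<lambda>x. ennreal (indicator Q x / R ^ card I)))"
        unfolding Md[symmetric] by standard
    qed (auto intro: L.sigma_finite_measure_axioms)
    also have "(\<integral>z. H' z \<partial>\<dots>) = (\<integral>z. (1 / R ^ card I)\<^sup>2 * g z \<partial>(L \<Otimes>\<^sub>M L))"
    proof -
      have "(\<lambda>(x, y). ennreal (indicator Q x / R ^ card I) * ennreal (indicator Q y / R ^ card I)) =
        (\<lambda>z. ennreal (indicator Q (fst z) / R ^ card I * (indicator Q (snd z) / R ^ card I)))"
        using R by (auto simp: fun_eq_iff ennreal_mult' simp flip: ennreal_mult')
      then show ?thesis
        using R by (simp only:, subst integral_density)
          (auto simp: g_def power2_eq_square mult_ac divide_simps intro!: Bochner_Integration.integral_cong)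
    qed
    also have "\<dots> = (1 / R ^ card I)\<^sup>2 * (\<integral>z. g z \<partial>(L \<Otimes>\<^sub>M L))" by simp
    finally have "0 \<le> (1 / R ^ card I)\<^sup>2 * (\<integral>z. g z \<partial>(L \<Otimes>\<^sub>M L))" .
    moreover have "(1 / R ^ card I)\<^sup>2 > 0" using R by simp
    ultimately have g0: "0 \<le> (\<integral>z. g z \<partial>(L \<Otimes>\<^sub>M L))"
      unfolding zero_le_mult_iff by linarith
    have gi: "integrable (L \<Otimes>\<^sub>M L) g"
    proof (rule integrableI_bounded_set[where A = "Q \<times> Q" and B = C])
      show "emeasure (L \<Otimes>\<^sub>M L) (Q \<times> Q) < \<infinity>"
        by (simp add: L.emeasure_pair_measure_Times emQ ennreal_mult_less_top)
    qed (use C bound in \<open>auto simp: g_def H'_def indicator_def abs_mult\<close>)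
    \<comment> \<open>This is \<open>g\<close> in the coordinates \<open>z = x - y\<close> and
      \<open>y\<close>, so that the factor \<open>H z\<close> is free of \<open>y\<close>.\<close>
    define g' where "g' z y = H z * (indicator Q (\<lambda>i\<in>I. z i + y i) * indicator Q y)" for z y
    have g'_meas[measurable]: "(\<lambda>z. g' (fst z) (snd z)) \<in> borel_measurable (L \<Otimes>\<^sub>M L)"
      unfolding g'_def by measurable
    \<comment> \<open>\<open>g'\<close> vanishes unless \<open>y\<close> lies in the cube and every
      \<open>z i\<close> lies in [-R, R]. It is thus bounded and supported on a set of finite
      measure, which justifies Fubini.\<close>
    have g'i: "integrable (L \<Otimes>\<^sub>M L) (\<lambda>(z, y). g' z y)"
    proof (rule integrableI_bounded_set[where A = "Pi\<^sub>E I (\<lambda>_. {-R..R}) \<times> Q" and B = C])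
      have "emeasure L (Pi\<^sub>E I (\<lambda>_. {-R..R})) = ennreal ((2 * R) ^ card I)"
        unfolding L_def using I R by (subst emeasure_PiM) (auto simp: ennreal_power)
      moreover have P: "Pi\<^sub>E I (\<lambda>_. {-R..R}) \<in> sets L"
        unfolding L_def using I by (intro sets_PiM_I_finite) auto
      ultimately show "emeasure (L \<Otimes>\<^sub>M L) (Pi\<^sub>E I (\<lambda>_. {-R..R}) \<times> Q) < \<infinity>"
        by (simp add: L.emeasure_pair_measure_Times emQ ennreal_mult_less_top)
      show "Pi\<^sub>E I (\<lambda>_. {-R..R}) \<times> Q \<in> sets (L \<Otimes>\<^sub>M L)" using P by measurable
      show "AE x in L \<Otimes>\<^sub>M L. x \<notin> Pi\<^sub>E I (\<lambda>_. {- R..R}) \<times> Q \<longrightarrow> (case x of (z, y) \<Rightarrow> g' z y) = 0"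
      proof (intro AE_I2 impI)
        fix x assume x: "x \<in> space (L \<Otimes>\<^sub>M L)" "x \<notin> Pi\<^sub>E I (\<lambda>_. {- R..R}) \<times> Q"
        obtain z y where zy: "x = (z, y)" by force
        have "g' z y = 0"
        proof (rule ccontr)
          assume "g' z y \<noteq> 0"
          then have *: "(\<lambda>i\<in>I. z i + y i) \<in> Q" "y \<in> Q" by (auto simp: g'_def indicator_def split: if_splits)
          have "z i \<in> {-R..R}" if "i \<in> I" for i
            using *[unfolded Q_def PiE_iff] that by force
          moreover have "z \<in> extensional I" using x zy by (simp add: space_pair_measure spL PiE_iff)
          ultimately have "x \<in> Pi\<^sub>E I (\<lambda>_. {- R..R}) \<times> Q" using zy * by (auto simp: PiE_iff)
          with x show False by simp
        qed
        then show "(case x of (z, y) \<Rightarrow> g' z y) = 0" by (simp add: zy)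
      qed
    qed (use C bound in \<open>auto simp: g'_def indicator_def abs_mult split_beta\<close>)
    have "(\<integral>z. g z \<partial>(L \<Otimes>\<^sub>M L)) = (\<integral>y. \<integral>x. g (x, y) \<partial>L \<partial>L)"
      using gi LL.integral_snd[of "\<lambda>x y. g (x, y)"] by simp
    also have "\<dots> = (\<integral>y. \<integral>z. g' z y \<partial>L \<partial>L)"
    proof (rule Bochner_Integration.integral_cong[OF refl])
      fix y assume y: "y \<in> space L"
      have "(\<integral>x. g (x, y) \<partial>L) = (\<integral>x. g (x, y) \<partial>distr L L (\<lambda>x. \<lambda>i\<in>I. x i + y i))"
        unfolding L_def distr_PiM_lborel_plus[OF I] ..
      also have "\<dots> = (\<integral>z. g ((\<lambda>i\<in>I. z i + y i), y) \<partial>L)"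
        using y by (subst integral_distr) auto
      also have "\<dots> = (\<integral>z. g' z y \<partial>L)"
      proof (rule Bochner_Integration.integral_cong[OF refl])
        fix z assume "z \<in> space L"
        then have "(\<lambda>i\<in>I. (if i \<in> I then z i + y i else undefined) - y i) = z"
          by (auto simp: spL PiE_iff extensional_def fun_eq_iff)
        then show "g ((\<lambda>i\<in>I. z i + y i), y) = g' z y"
          by (simp add: g_def g'_def H'_def restrict_def mult_ac)
      qed
      finally show "(\<integral>x. g (x, y) \<partial>L) = (\<integral>z. g' z y \<partial>L)" .
    qed
    also have "\<dots> = (\<integral>z. \<integral>y. g' z y \<partial>L \<partial>L)"
      using LL.Fubini_integral[OF g'i] .
    also have "\<dots> = (\<integral>z. R ^ card I * (W R z * H z) \<partial>L)"
    proof (rule Bochner_Integration.integral_cong[OF refl])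
      fix z assume z: "z \<in> space L"
      \<comment> \<open>The set of those \<open>y\<close> for which both \<open>y\<close> and
        \<open>z + y\<close> lie in the cube; its side lengths are
        \<open>max 0 (R - \<bar>z i\<bar>)\<close>.\<close>
      define P where "P = Pi\<^sub>E I (\<lambda>i. {max 0 (- z i)..min R (R - z i)})"
      have P: "P \<in> sets L" unfolding P_def L_def using I by (intro sets_PiM_I_finite) auto
      have "indicator Q (\<lambda>i\<in>I. z i + y i) * indicator Q y = (indicator P y :: real)" if "y \<in> space L" for y
      proof -
        have "(\<lambda>i\<in>I. z i + y i) \<in> Q \<and> y \<in> Q \<longleftrightarrow> y \<in> P"
          using that unfolding Q_def P_def spL PiE_iff by (auto simp: algebra_simps) 
        then show ?thesis by (auto simp: indicator_def)
      qed
      then have "(\<integral>y. g' z y \<partial>L) = (\<integral>y. H z * indicator P y \<partial>L)"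
        by (intro Bochner_Integration.integral_cong) (auto simp: g'_def)
      also have "\<dots> = H z * measure L P"
        using P sets.sets_into_space[OF P] by (simp add: Int_absorb2)
      also have "measure L P = (\<Prod>i\<in>I. max 0 (R - \<bar>z i\<bar>))"
      proof -
        have "emeasure L P = (\<Prod>i\<in>I. ennreal (max 0 (R - \<bar>z i\<bar>)))"
          unfolding P_def L_def using I
          by (subst emeasure_PiM) (auto intro!: prod.cong simp: emeasure_lborel_Icc_eq max_def min_def abs_if)
        also have "\<dots> = ennreal (\<Prod>i\<in>I. max 0 (R - \<bar>z i\<bar>))"
          by (rule prod_ennreal) simp
        finally show ?thesis
          unfolding measure_def by (simp only:) (intro enn2real_ennreal prod_nonneg, simp)
      qed
      also have "\<dots> = (\<Prod>i\<in>I. R * max 0 (1 - \<bar>z i\<bar> / R))"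
        using R by (intro prod.cong) (auto simp: max_def field_simps)
      also have "\<dots> = R ^ card I * W R z"
        by (simp add: W_def prod.distrib)
      finally show "(\<integral>y. g' z y \<partial>L) = R ^ card I * (W R z * H z)" by simp
    qed
    also have "\<dots> = R ^ card I * (\<integral>z. W R z * H z \<partial>L)" by simp
    finally have "0 \<le> R ^ card I * (\<integral>z. W R z * H z \<partial>L)" using g0 by simp
    moreover have "R ^ card I > 0" using R by simp
    ultimately show ?thesis by (simp add: zero_le_mult_iff)
  qed
  have "(\<lambda>n. \<integral>z. W (real (Suc n)) z * H z \<partial>L) \<longlonglongrightarrow> (\<integral>z. H z \<partial>L)"
  proof (rule integral_dominated_convergence[where w = "\<lambda>z. norm (H z)"])
    show "integrable L (\<lambda>z. norm (H z))" using int by auto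
    show "AE z in L. (\<lambda>n. W (real (Suc n)) z * H z) \<longlonglongrightarrow> H z"
    proof (rule AE_I2)
      fix z :: "'i \<Rightarrow> real"
      have "(\<lambda>n. max 0 (1 - \<bar>z i\<bar> / real (Suc n))) \<longlonglongrightarrow> max 0 (1 - 0)" for i
        by (rule tendsto_max[OF tendsto_const tendsto_diff[OF tendsto_const
              LIMSEQ_Suc[OF lim_const_over_n]]])
      then have "(\<lambda>n. W (real (Suc n)) z) \<longlonglongrightarrow> (\<Prod>i\<in>I. max 0 (1 - 0))"
        unfolding W_def by (intro tendsto_prod) 
      then have "(\<lambda>n. W (real (Suc n)) z * H z) \<longlonglongrightarrow> 1 * H z"
        by (intro tendsto_mult tendsto_const) simp
      then show "(\<lambda>n. W (real (Suc n)) z * H z) \<longlonglongrightarrow> H z" by simp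
    qed
    show "AE z in L. norm (W (real (Suc n)) z * H z) \<le> norm (H z)" for n
    proof (rule AE_I2)
      fix z :: "'i \<Rightarrow> real"
      have "\<bar>W (real (Suc n)) z\<bar> \<le> 1"
        unfolding W_def abs_prod by (intro prod_le_1) auto
      then show "norm (W (real (Suc n)) z * H z) \<le> norm (H z)"
        by (simp add: abs_mult mult_left_le_one_le)
    qed
  qed auto
  then show ?thesis
    by (rule LIMSEQ_le_const) (use step in auto)
qed

text \<open>Restrict to \<open>m\<close> of the coordinates. By the addition formula, multiplying by
  \<open>cos (s * z i)\<close> splits the double sum into two instances of \<open>pd\<close>, with
  cosine and sine weights. The integral of this positive definite function is nonnegative, and
  \<open>radial_integral_cos\<close> identifies it as a positive multiple of the Hankel
  transform.\<close>

lemma hankel_transform_nonneg: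
  fixes A :: "real \<Rightarrow> real"
  assumes cont: "continuous_on UNIV A"
    and pd: "\<And>(N::nat) (x :: nat \<Rightarrow> real ^ 'd::finite) a.
        0 \<le> (\<Sum>p<N. \<Sum>q<N. a p * a q * A (norm (x p - x q)))"
    and m: "1 \<le> m" "m \<le> CARD('d)"
    and int: "integrable lborel (\<lambda>u. indicator {0..} u * (u ^ (m - 1) * A u))"
  shows "0 \<le> (\<integral>u. indicator {0..} u * (u ^ (m - 1) * bessel_kernel m (s * u) * A u) \<partial>lborel)"
proof -
  obtain I :: "'d set" where I: "card I = m"
    by (rule obtain_subset_with_card_n[OF m(2)])
  have fin: "finite I" by simp
  have "I \<noteq> {}" using I m(1) by auto
  then obtain i where i: "i \<in> I" by auto
  have [measurable]: "A \<in> borel_measurable borel"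
    using cont by (rule borel_measurable_continuous_onI)
  have Abound: "\<bar>A r\<bar> \<le> A 0" if r: "r \<ge> 0" for r
  proof -
    obtain e :: "real ^ 'd" where e: "norm e = r"
      by (rule vector_choose_size[OF r])
    \<comment> \<open>Two points at distance \<open>r\<close> with weights 1 and \<open>c\<close>;
      the values 1 and -1 of \<open>c\<close> give the two bounds.\<close>
    have "0 \<le> A 0 + c * A r + (c * A r + c * c * A 0)" for c
      using pd[where N = 2 and x = "\<lambda>p. if p = 0 then 0 else e" and a = "\<lambda>p. if p = 0 then 1 else c"] e
      by (simp add: numeral_2_eq_2)
    from this[of 1] this[of "-1"] show ?thesis by auto
  qed
  define L where "L = Pi\<^sub>M I (\<lambda>_. lborel :: real measure)"
  define H where "H z = cos (s * z i) * A (L2_set z I)" for z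
  note R = radial_integral_cos[OF fin i, unfolded I, OF _ int]
  have [measurable]: "(\<lambda>x. L2_set x I) \<in> borel_measurable L"
    unfolding L2_set_def L_def by measurable
  have [measurable]: "(\<lambda>x. x i) \<in> borel_measurable L"
    unfolding L_def using i by measurable
  have "0 \<le> (\<integral>z. H z \<partial>L)"
    unfolding L_def
  proof (rule pos_def_integral_nonneg[OF fin])
    show "integrable (Pi\<^sub>M I (\<lambda>_. lborel)) H"
      unfolding L_def[symmetric]
    proof (rule Bochner_Integration.integrable_bound)
      show "integrable L (\<lambda>x. A (L2_set x I))" unfolding L_def by (rule R(1)) simp
      show "H \<in> borel_measurable L" unfolding H_def[abs_def] by measurable
      show "AE x in L. norm (H x) \<le> norm (A (L2_set x I))"
        by (simp add: H_def abs_mult mult_left_le_one_le)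
    qed
    show "\<bar>H z\<bar> \<le> A 0" for z
    proof -
      have "\<bar>cos (s * z i)\<bar> * \<bar>A (L2_set z I)\<bar> \<le> 1 * A 0"
        by (intro mult_mono Abound L2_set_nonneg) auto
      then show ?thesis by (simp add: H_def abs_mult)
    qed
    show "0 \<le> (\<Sum>p<N. \<Sum>q<N. H (\<lambda>i\<in>I. x p i - x q i))" for N :: nat and x
    proof -
      \<comment> \<open>Padding with zeros embeds the \<open>m\<close>-dimensional points
        isometrically in the full space.\<close>
      define e :: "nat \<Rightarrow> real ^ 'd" where "e p = (\<chi> j. if j \<in> I then x p j else 0)" for p
      have nrm: "L2_set (\<lambda>i\<in>I. x p i - x q i) I = norm (e p - e q)" for p q
      proof -
        have "norm (e p - e q) = L2_set (\<lambda>j. if j \<in> I then x p j - x q j else 0) UNIV"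
          by (auto simp: norm_vec_def L2_set_def e_def intro!: sum.cong)
        also have "\<dots> = L2_set (\<lambda>i\<in>I. x p i - x q i) I"
          unfolding L2_set_def by (intro arg_cong[where f = sqrt] sum.mono_neutral_cong_right) auto
        finally show ?thesis ..
      qed
      have "H (\<lambda>i\<in>I. x p i - x q i) =
          cos (s * x p i) * cos (s * x q i) * A (norm (e p - e q)) +
          sin (s * x p i) * sin (s * x q i) * A (norm (e p - e q))" for p q
        using i by (simp add: H_def nrm right_diff_distrib cos_diff algebra_simps)
      then have "(\<Sum>p<N. \<Sum>q<N. H (\<lambda>i\<in>I. x p i - x q i)) =
          (\<Sum>p<N. \<Sum>q<N. cos (s * x p i) * cos (s * x q i) * A (norm (e p - e q))) +
          (\<Sum>p<N. \<Sum>q<N. sin (s * x p i) * sin (s * x q i) * A (norm (e p - e q)))"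
        by (simp only: sum.distrib)
      also have "\<dots> \<ge> 0" by (intro add_nonneg_nonneg pd)
      finally show ?thesis .
    qed
  qed
  also have "(\<integral>z. H z \<partial>L) = 2 * pi powr (real m / 2) *
      (\<integral>u. indicator {0..} u * (u ^ (m - 1) * bessel_kernel m (s * u) * A u) \<partial>lborel)"
    unfolding H_def L_def by (rule R(2)) simp
  finally show ?thesis by (simp add: zero_le_mult_iff)
qed

section \<open>Pairing with a Gaussian\<close>

lemma integrable_half_gaussian_moment:
  "integrable lborel (\<lambda>v::real. indicator {0..} v * (v ^ k * exp (- v\<^sup>2 / 2)))"
proof -
  have "integrable lborel (\<lambda>v::real. sqrt (2 * pi) * (std_normal_density v * v ^ k))"
    by (intro integrable_mult_right integrable_std_normal_moment)
  then have "integrable lborel (\<lambda>v::real. v ^ k * exp (- v\<^sup>2 / 2))"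
    by (simp add: std_normal_density_def mult_ac)
  from integrable_mult_indicator[OF _ this, of "{0..}"] show ?thesis by simp
qed

text \<open>The real part of the characteristic function of the standard normal law, with the
  normalising factor moved to the right.\<close>

lemma has_bochner_integral_cos_gaussian:
  "has_bochner_integral lborel (\<lambda>x. cos (u * x) * exp (- x\<^sup>2 / 2)) (sqrt (2 * pi) * exp (- u\<^sup>2 / 2))"
proof -
  interpret prob_space std_normal_distribution
    by (rule prob_space_normal_density) simp
  have i: "integrable std_normal_distribution (\<lambda>x. iexp (u * x))"
    by (rule integrable_const_bound[where B = 1]) auto
  have "(\<integral>x. iexp (u * x) \<partial>std_normal_distribution) = complex_of_real (exp (- u\<^sup>2 / 2))"
    using char_std_normal_distribution unfolding char_def by (simp add: fun_eq_iff)
  then have "Re (\<integral>x. iexp (u * x) \<partial>std_normal_distribution) = exp (- u\<^sup>2 / 2)" by simp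
  then have "(\<integral>x. cos (u * x) \<partial>std_normal_distribution) = exp (- u\<^sup>2 / 2)"
    using integral_Re[OF i] by (simp add: Re_exp)
  moreover have "integrable std_normal_distribution (\<lambda>x. cos (u * x))"
    by (rule integrable_const_bound[where B = 1]) auto
  ultimately have "has_bochner_integral lborel (\<lambda>x. std_normal_density x * cos (u * x)) (exp (- u\<^sup>2 / 2))"
    by (simp add: has_bochner_integral_iff integral_density integrable_density normal_density_nonneg)
  then have "has_bochner_integral lborel (\<lambda>x. sqrt (2 * pi) * (std_normal_density x * cos (u * x))) (sqrt (2 * pi) * exp (- u\<^sup>2 / 2))"
    by (rule has_bochner_integral_mult_right)
  then show ?thesis
    by (simp add: std_normal_density_def mult_ac)
qed

text \<open>The Gaussian on \<open>m\<close>-space is a product, so its Fourier transform is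
  computed coordinate by coordinate; \<open>radial_integral_cos\<close> converts it into the
  integral over the half-line.\<close>

lemma hankel_gaussian:
  assumes "m \<ge> 1"
  shows "(\<integral>v. indicator {0..} v * (v ^ (m - 1) * bessel_kernel m (u * v) * exp (- v\<^sup>2 / 2)) \<partial>lborel) =
     sqrt (2 * pi) ^ m / (2 * pi powr (real m / 2)) * exp (- u\<^sup>2 / 2)"
proof -
  interpret product_sigma_finite "\<lambda>_::nat. lborel :: real measure" by standard
  let ?I = "{..<m}"
  \<comment> \<open>The frequency vector points along coordinate 0, so the cosine sits in that
    factor alone.\<close>
  define F where "F j x = (if j = 0 then cos (u * x) else 1) * exp (- x\<^sup>2 / 2)" for j :: nat and x :: real
  have F: "has_bochner_integral lborel (F j) (if j = 0 then sqrt (2 * pi) * exp (- u\<^sup>2 / 2) else sqrt (2 * pi))" for j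
    using has_bochner_integral_cos_gaussian[of u] has_bochner_integral_cos_gaussian[of 0]
    unfolding F_def[abs_def] by simp
  have "2 * pi powr (real m / 2) * (\<integral>v. indicator {0..} v * (v ^ (m - 1) * bessel_kernel m (u * v) * exp (- v\<^sup>2 / 2)) \<partial>lborel)
      = (\<integral>x. cos (u * x 0) * exp (- (L2_set x ?I)\<^sup>2 / 2) \<partial>Pi\<^sub>M ?I (\<lambda>_. lborel))"
    using radial_integral_cos(2)[of ?I 0 "\<lambda>v. exp (- v\<^sup>2 / 2)" u] integrable_half_gaussian_moment[of "m - 1"] assms
    by simp
  also have "\<dots> = (\<integral>x. (\<Prod>j<m. F j (x j)) \<partial>Pi\<^sub>M ?I (\<lambda>_. lborel))"
  proof (rule Bochner_Integration.integral_cong[OF refl])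
    fix x :: "nat \<Rightarrow> real"
    have "(\<Prod>j<m. F j (x j)) = (\<Prod>j<m. if j = 0 then cos (u * x j) else 1) * (\<Prod>j<m. exp (- (x j)\<^sup>2 / 2))"
      unfolding F_def by (rule prod.distrib)
    also have "(\<Prod>j<m. if j = 0 then cos (u * x j) else 1) = cos (u * x 0)"
      using assms by (subst prod.delta) auto
    also have "(\<Prod>j<m. exp (- (x j)\<^sup>2 / 2)) = exp (- (L2_set x ?I)\<^sup>2 / 2)"
      by (simp add: exp_sum[symmetric] L2_set_def sum_nonneg sum_negf sum_divide_distrib)
    finally show "cos (u * x 0) * exp (- (L2_set x ?I)\<^sup>2 / 2) = (\<Prod>j<m. F j (x j))" ..
  qed
  also have "\<dots> = (\<Prod>j<m. integral\<^sup>L lborel (F j))"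
    by (rule product_integral_prod) (use F in \<open>auto simp: has_bochner_integral_iff\<close>)
  also have "\<dots> = (\<Prod>j<m. if j = 0 then sqrt (2 * pi) * exp (- u\<^sup>2 / 2) else sqrt (2 * pi))"
    using has_bochner_integral_integral_eq[OF F] by simp
  also have "\<dots> = (\<Prod>j<m. sqrt (2 * pi) * (if j = 0 then exp (- u\<^sup>2 / 2) else 1))"
    by (intro prod.cong) auto
  also have "\<dots> = sqrt (2 * pi) ^ m * exp (- u\<^sup>2 / 2)"
    using assms by (subst prod.distrib, subst prod.delta) auto
  finally show ?thesis by (simp add: field_simps)
qed

text \<open>The case \<open>u = 0\<close> of \<open>hankel_gaussian\<close> evaluates the integral
  up to the positive factor \<open>bessel_kernel m 0\<close>.\<close>

lemma half_gaussian_moment_pos: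
  assumes "m \<ge> 1"
  shows "0 < (\<integral>v. indicator {0..} v * ((v::real) ^ (m - 1) * exp (- v\<^sup>2 / 2)) \<partial>lborel)"
proof -
  have "(\<integral>v. indicator {0..} v * (v ^ (m - 1) * bessel_kernel m (0 * v) * exp (- v\<^sup>2 / 2)) \<partial>lborel)
      = (\<integral>v. bessel_kernel m 0 * (indicator {0..} v * (v ^ (m - 1) * exp (- v\<^sup>2 / 2))) \<partial>lborel)"
    by (intro Bochner_Integration.integral_cong) auto
  also have "\<dots> = bessel_kernel m 0 * (\<integral>v. indicator {0..} v * (v ^ (m - 1) * exp (- v\<^sup>2 / 2)) \<partial>lborel)"
    by (rule integral_mult_right_zero)
  finally have "bessel_kernel m 0 * (\<integral>v. indicator {0..} v * (v ^ (m - 1) * exp (- v\<^sup>2 / 2)) \<partial>lborel)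
      = sqrt (2 * pi) ^ m / (2 * pi powr (real m / 2)) * exp (- 0\<^sup>2 / 2)"
    unfolding hankel_gaussian[OF assms] by (rule sym)
  also have "\<dots> > 0" by simp
  finally have "bessel_kernel m 0 * (\<integral>v. indicator {0..} v * (v ^ (m - 1) * exp (- v\<^sup>2 / 2)) \<partial>lborel) > 0" .
  moreover have "bessel_kernel m 0 > 0"
    unfolding bessel_kernel_0 using assms by (auto intro!: Gamma_real_pos)
  ultimately show ?thesis by (simp add: zero_less_mult_iff)
qed

lemma integrable_prod_lborel:
  fixes f g :: "real \<Rightarrow> real"
  assumes "integrable lborel f" "integrable lborel g"
  shows "integrable (lborel \<Otimes>\<^sub>M lborel) (\<lambda>z. f (fst z) * g (snd z))"
proof (rule lborel_pair.Fubini_integrable)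
  have [measurable]: "f \<in> borel_measurable lborel" "g \<in> borel_measurable lborel" using assms by auto
  show "(\<lambda>z. f (fst z) * g (snd z)) \<in> borel_measurable (lborel \<Otimes>\<^sub>M lborel)" by measurable
qed (use assms in \<open>auto simp: abs_mult\<close>)

text \<open>Fubini moves the Hankel transform from \<open>f\<close> to the Gaussian, which
  reproduces itself up to a constant. Boundedness of the kernel makes the double integral absolutely
  convergent.\<close>

lemma hankel_gaussian_pairing:
  fixes f :: "real \<Rightarrow> real"
  assumes m: "m \<ge> 1" and f[measurable]: "f \<in> borel_measurable borel"
    and int: "integrable lborel (\<lambda>u. indicator {0..} u * (u ^ (m - 1) * f u))"
  defines "T \<equiv> \<lambda>s. \<integral>u. indicator {0..} u * (u ^ (m - 1) * bessel_kernel m (s * u) * f u) \<partial>lborel"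
  shows "(\<integral>v. indicator {0..} v * (v ^ (m - 1) * exp (- v\<^sup>2 / 2)) * T (\<sigma> * v) \<partial>lborel) =
     sqrt (2 * pi) ^ m / (2 * pi powr (real m / 2)) *
       (\<integral>u. indicator {0..} u * (u ^ (m - 1) * f u) * exp (- (\<sigma> * u)\<^sup>2 / 2) \<partial>lborel)"
proof -
  note [measurable] = borel_measurable_bessel_kernel[OF m]
  define A where "A u = indicator {0..} u * (u ^ (m - 1) * f u)" for u
  define G where "G v = indicator {0..} v * (v ^ (m - 1) * exp (- v\<^sup>2 / 2))" for v :: real
  have [measurable]: "A \<in> borel_measurable borel" "G \<in> borel_measurable borel"
    unfolding A_def[abs_def] G_def[abs_def] by measurable
  have i: "integrable (lborel \<Otimes>\<^sub>M lborel) (\<lambda>(u, v). A u * G v * bessel_kernel m (\<sigma> * v * u))"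
  proof (rule Bochner_Integration.integrable_bound)
    show "integrable (lborel \<Otimes>\<^sub>M lborel) (\<lambda>z. bessel_kernel m 0 * (A (fst z) * G (snd z)))"
      using int integrable_half_gaussian_moment[of "m - 1"]
      by (intro integrable_mult_right integrable_prod_lborel) (auto simp: A_def[abs_def] G_def[abs_def])
    show "AE z in lborel \<Otimes>\<^sub>M lborel. norm (case z of (u, v) \<Rightarrow> A u * G v * bessel_kernel m (\<sigma> * v * u)) \<le>
        norm (bessel_kernel m 0 * (A (fst z) * G (snd z)))"
    proof (rule AE_I2)
      fix z :: "real \<times> real"
      have "\<bar>bessel_kernel m (\<sigma> * snd z * fst z)\<bar> * \<bar>A (fst z) * G (snd z)\<bar> \<le> \<bar>bessel_kernel m 0\<bar> * \<bar>A (fst z) * G (snd z)\<bar>"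
        using abs_bessel_kernel_le[OF m, of "\<sigma> * snd z * fst z"] by (intro mult_right_mono) auto
      then show "norm (case z of (u, v) \<Rightarrow> A u * G v * bessel_kernel m (\<sigma> * v * u)) \<le>
        norm (bessel_kernel m 0 * (A (fst z) * G (snd z)))"
        by (simp add: split_beta abs_mult mult_ac)
    qed
  qed measurable
  have "(\<integral>v. G v * T (\<sigma> * v) \<partial>lborel) = (\<integral>v. \<integral>u. A u * G v * bessel_kernel m (\<sigma> * v * u) \<partial>lborel \<partial>lborel)"
    unfolding T_def integral_mult_right_zero[symmetric]
    by (intro Bochner_Integration.integral_cong) (auto simp: A_def mult_ac)
  also have "\<dots> = (\<integral>u. \<integral>v. A u * G v * bessel_kernel m (\<sigma> * v * u) \<partial>lborel \<partial>lborel)"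
    using lborel_pair.Fubini_integral[OF i] .
  also have "\<dots> = (\<integral>u. A u * (\<integral>v. indicator {0..} v * (v ^ (m - 1) * bessel_kernel m (\<sigma> * u * v) * exp (- v\<^sup>2 / 2)) \<partial>lborel) \<partial>lborel)"
    unfolding integral_mult_right_zero[symmetric]
    by (intro Bochner_Integration.integral_cong) (auto simp: G_def mult_ac)
  also have "\<dots> = (\<integral>u. sqrt (2 * pi) ^ m / (2 * pi powr (real m / 2)) * (A u * exp (- (\<sigma> * u)\<^sup>2 / 2)) \<partial>lborel)"
    unfolding hankel_gaussian[OF m] by (intro Bochner_Integration.integral_cong) (auto simp: mult_ac)
  also have "\<dots> = sqrt (2 * pi) ^ m / (2 * pi powr (real m / 2)) * (\<integral>u. A u * exp (- (\<sigma> * u)\<^sup>2 / 2) \<partial>lborel)"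
    by (rule integral_mult_right_zero)
  finally show ?thesis unfolding A_def G_def .
qed

text \<open>Pairing with the Gaussian gives
  \<open>\<kappa> * E \<sigma> = C * G d * \<sigma> ^ d\<close>. As \<open>E\<close> converges along
  the integers, dividing by \<open>\<sigma> ^ d\<close> forces \<open>C * G d = 0\<close>; then
  \<open>E\<close> vanishes at all positive integers, against its positive limit.\<close>

lemma hankel_transform_not_monomial:
  fixes f :: "real \<Rightarrow> real"
  assumes m: "1 \<le> m" "m \<le> d" and cont: "continuous_on UNIV f"
    and int: "integrable lborel (\<lambda>u. indicator {0..} u * (u ^ (m - 1) * f u))"
    and bound: "\<And>u. \<bar>f u\<bar> \<le> f 0" and pos: "f 0 > 0"
    and mono: "\<And>s. s > 0 \<Longrightarrow> (\<integral>u. indicator {0..} u * (u ^ (m - 1) * bessel_kernel m (s * u) * f u) \<partial>lborel) = C * s ^ (d - m)"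
  shows False
proof -
  have f[measurable]: "f \<in> borel_measurable borel" using cont by (rule borel_measurable_continuous_onI)
  define \<kappa> where "\<kappa> = sqrt (2 * pi) ^ m / (2 * pi powr (real m / 2))"
  have \<kappa>: "\<kappa> > 0" by (simp add: \<kappa>_def)
  define G where "G k = (\<integral>v. indicator {0..} v * ((v::real) ^ (k - 1) * exp (- v\<^sup>2 / 2)) \<partial>lborel)" for k :: nat
  define E where "E \<sigma> = (\<integral>w. indicator {0..} w * (w ^ (m - 1) * exp (- w\<^sup>2 / 2)) * f (w / \<sigma>) \<partial>lborel)" for \<sigma>
  have key: "\<kappa> * E \<sigma> = C * G d * \<sigma> ^ d" if \<sigma>: "\<sigma> > 0" for \<sigma>
  proof -
    have "C * \<sigma> ^ (d - m) * G d =
       (\<integral>v. C * \<sigma> ^ (d - m) * (indicator {0..} v * (v ^ (d - 1) * exp (- v\<^sup>2 / 2))) \<partial>lborel)"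
      unfolding G_def integral_mult_right_zero ..
    also have "\<dots> = (\<integral>v. indicator {0..} v * (v ^ (m - 1) * exp (- v\<^sup>2 / 2)) *
         (\<integral>u. indicator {0..} u * (u ^ (m - 1) * bessel_kernel m (\<sigma> * v * u) * f u) \<partial>lborel) \<partial>lborel)"
    proof (rule integral_cong_AE)
      show "AE v in lborel. C * \<sigma> ^ (d - m) * (indicator {0..} v * (v ^ (d - 1) * exp (- v\<^sup>2 / 2))) =
        indicator {0..} v * (v ^ (m - 1) * exp (- v\<^sup>2 / 2)) *
         (\<integral>u. indicator {0..} u * (u ^ (m - 1) * bessel_kernel m (\<sigma> * v * u) * f u) \<partial>lborel)"
        \<comment> \<open>The hypothesis \<open>mono\<close> covers positive frequencies only, hence
          the exclusion of \<open>v = 0\<close>.\<close>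
        using AE_lborel_singleton[of 0]
      proof eventually_elim
        case (elim v)
        have "v ^ (d - 1) = v ^ (m - 1) * v ^ (d - m)" using m by (simp flip: power_add)
        then show ?case using elim \<sigma> mono[of "\<sigma> * v"]
          by (cases "v > 0") (auto simp: power_mult_distrib mult_ac)
      qed
    next
      note [measurable] = borel_measurable_bessel_kernel[OF m(1)]
      show "(\<lambda>v. indicator {0..} v * (v ^ (m - 1) * exp (- v\<^sup>2 / 2)) *
         (\<integral>u. indicator {0..} u * (u ^ (m - 1) * bessel_kernel m (\<sigma> * v * u) * f u) \<partial>lborel)) \<in> borel_measurable lborel"
        by measurable
    qed measurable
    also have "\<dots> = \<kappa> * (\<integral>u. indicator {0..} u * (u ^ (m - 1) * f u) * exp (- (\<sigma> * u)\<^sup>2 / 2) \<partial>lborel)"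
      unfolding \<kappa>_def using hankel_gaussian_pairing[OF m(1) f int, of \<sigma>] by (simp add: mult.assoc)
    \<comment> \<open>Substituting \<open>u = w / \<sigma>\<close> moves the dilation from the
      Gaussian to \<open>f\<close>, where continuity at 0 can be applied.\<close>
    also have "(\<integral>u. indicator {0..} u * (u ^ (m - 1) * f u) * exp (- (\<sigma> * u)\<^sup>2 / 2) \<partial>lborel)
       = (1 / \<sigma>) * (\<integral>w. indicator {0..} (w / \<sigma>) * ((w / \<sigma>) ^ (m - 1) * f (w / \<sigma>)) * exp (- w\<^sup>2 / 2) \<partial>lborel)"
      using \<sigma> by (subst lborel_integral_real_affine[of "1 / \<sigma>" _ 0]) auto
    also have "(\<integral>w. indicator {0..} (w / \<sigma>) * ((w / \<sigma>) ^ (m - 1) * f (w / \<sigma>)) * exp (- w\<^sup>2 / 2) \<partial>lborel)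
       = (\<integral>w. (1 / \<sigma> ^ (m - 1)) * (indicator {0..} w * (w ^ (m - 1) * exp (- w\<^sup>2 / 2)) * f (w / \<sigma>)) \<partial>lborel)"
      using \<sigma> by (intro Bochner_Integration.integral_cong)
        (auto simp: indicator_def power_divide zero_le_divide_iff)
    also have "\<dots> = (1 / \<sigma> ^ (m - 1)) * E \<sigma>" unfolding E_def by (rule integral_mult_right_zero)
    finally have "C * \<sigma> ^ (d - m) * G d = \<kappa> * (1 / \<sigma> * (1 / \<sigma> ^ (m - 1) * E \<sigma>))" .
    also have "\<dots> = \<kappa> * E \<sigma> / \<sigma> ^ m" using m by (cases m) auto
    finally have "C * \<sigma> ^ (d - m) * G d * \<sigma> ^ m = \<kappa> * E \<sigma>" using \<sigma> by (simp add: field_simps)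
    moreover have "\<sigma> ^ d = \<sigma> ^ (d - m) * \<sigma> ^ m" using m by (simp flip: power_add)
    ultimately show ?thesis by (simp add: mult_ac)
  qed
  have lim: "(\<lambda>n. E (real (Suc n))) \<longlonglongrightarrow> (\<integral>w. indicator {0..} w * (w ^ (m - 1) * exp (- w\<^sup>2 / 2)) * f 0 \<partial>lborel)"
    unfolding E_def
  proof (rule integral_dominated_convergence[where w = "\<lambda>w. f 0 * (indicator {0..} w * (w ^ (m - 1) * exp (- w\<^sup>2 / 2)))"])
    show "integrable lborel (\<lambda>w. f 0 * (indicator {0..} w * (w ^ (m - 1) * exp (- w\<^sup>2 / 2))))"
      by (intro integrable_mult_right integrable_half_gaussian_moment)
    show "AE w in lborel. (\<lambda>n. indicator {0..} w * (w ^ (m - 1) * exp (- w\<^sup>2 / 2)) * f (w / real (Suc n)))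
        \<longlonglongrightarrow> indicator {0..} w * (w ^ (m - 1) * exp (- w\<^sup>2 / 2)) * f 0"
    proof (rule AE_I2)
      fix w :: real
      have "isCont f 0" using cont by (simp add: continuous_on_eq_continuous_at)
      from isCont_tendsto_compose[OF this LIMSEQ_Suc[OF lim_const_over_n[of w]]]
      show "(\<lambda>n. indicator {0..} w * (w ^ (m - 1) * exp (- w\<^sup>2 / 2)) * f (w / real (Suc n)))
        \<longlonglongrightarrow> indicator {0..} w * (w ^ (m - 1) * exp (- w\<^sup>2 / 2)) * f 0"
        by (rule tendsto_mult[OF tendsto_const])
    qed
    show "AE w in lborel. norm (indicator {0..} w * (w ^ (m - 1) * exp (- w\<^sup>2 / 2)) * f (w / real (Suc n)))
       \<le> f 0 * (indicator {0..} w * (w ^ (m - 1) * exp (- w\<^sup>2 / 2)))" for n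
    proof (rule AE_I2)
      fix w :: real
      have "indicator {0..} w * (w ^ (m - 1) * exp (- w\<^sup>2 / 2)) * \<bar>f (w / real (Suc n))\<bar>
        \<le> indicator {0..} w * (w ^ (m - 1) * exp (- w\<^sup>2 / 2)) * f 0"
        by (intro mult_left_mono bound) (auto simp: indicator_def)
      then show "norm (indicator {0..} w * (w ^ (m - 1) * exp (- w\<^sup>2 / 2)) * f (w / real (Suc n)))
       \<le> f 0 * (indicator {0..} w * (w ^ (m - 1) * exp (- w\<^sup>2 / 2)))"
        by (auto simp: indicator_def abs_mult mult_ac)
    qed
  qed measurable
  define l where "l = (\<integral>w. indicator {0..} w * (w ^ (m - 1) * exp (- w\<^sup>2 / 2)) * f 0 \<partial>lborel)"
  have l: "l > 0"
    unfolding l_def using half_gaussian_moment_pos[OF m(1)] pos by simp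
  have "(\<lambda>n. 1 / real (Suc n) ^ d) \<longlonglongrightarrow> 0"
  proof -
    have "(\<lambda>n. (1 / real (Suc n)) ^ d) \<longlonglongrightarrow> 0 ^ d"
      by (rule tendsto_power[OF LIMSEQ_Suc[OF lim_const_over_n[of 1]]])
    moreover have "(0::real) ^ d = 0" using m by simp
    ultimately show ?thesis by (simp only: power_divide power_one)
  qed
  from tendsto_mult[OF tendsto_mult[OF tendsto_const lim] this, of \<kappa>]
  have "(\<lambda>n. \<kappa> * E (real (Suc n)) * (1 / real (Suc n) ^ d)) \<longlonglongrightarrow> 0" by simp
  moreover have "\<kappa> * E (real (Suc n)) * (1 / real (Suc n) ^ d) = C * G d" for n
    by (subst key) auto
  ultimately have CG: "C * G d = 0" by (simp add: LIMSEQ_const_iff)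
  have "\<kappa> * E (real (Suc n)) = 0" for n
    using key[of "real (Suc n)"] unfolding CG by simp
  then have "E (real (Suc n)) = 0" for n
    using \<kappa> by simp
  then have "(\<lambda>n. 0) \<longlonglongrightarrow> l" using lim unfolding l_def by simp
  then have "l = 0" by (simp add: LIMSEQ_const_iff)
  with l show False by simp
qed

section \<open>Real analytic and positive definite functions\<close>

text \<open>An identity theorem. Agreement is propagated along the connected half-line; locally this
  is done by extending the power series to a complex disc and continuing analytically there.\<close>

lemma real_analytic_on_eq_monomial:
  fixes g :: "real \<Rightarrow> complex"
  assumes an: "real_analytic_on g {0<..}"
    and ab: "0 < a" "a < b" and eq: "\<And>y. a \<le> y \<Longrightarrow> y \<le> b \<Longrightarrow> g y = C * of_real y ^ n"
    and y: "y > 0"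
  shows "g y = C * of_real y ^ n"
proof -
  \<comment> \<open>Agreement on a neighbourhood rather than at a point, since the identity theorem
    needs zeros that accumulate.\<close>
  define P where "P x = (eventually (\<lambda>y. g y = C * of_real y ^ n) (nhds x))" for x
  have "P y"
  proof (rule connected_induction_simple[where S = "{0<..}" and P = P and a = "(a + b) / 2"])
    have "eventually (\<lambda>y. y \<in> {a<..<b}) (nhds ((a + b) / 2))"
      using ab by (intro eventually_nhds_in_open) auto
    then show "P ((a + b) / 2)"
      unfolding P_def by eventually_elim (auto intro: eq)
  next
    fix x :: real assume x: "x \<in> {0<..}"
    then obtain r c where r: "r > 0" and
      sums: "\<And>y. \<bar>y - x\<bar> < r \<Longrightarrow> (\<lambda>n. (y - x) ^ n *\<^sub>R c n) sums g y"
      using an unfolding real_analytic_on_def by blast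
    define X where "X = complex_of_real x"
    define F where "F z = (\<Sum>n. c n * (z - X) ^ n)" for z
    have Fsums: "(\<lambda>n. c n * (z - X) ^ n) sums F z" if z: "z \<in> ball X r" for z
    proof -
      have "cmod (z - X) < r" using z by (simp add: dist_norm norm_minus_commute)
      \<comment> \<open>The real point \<open>x + q\<close> is farther from the centre than
        \<open>z\<close>, and the given series converges there; hence the complex series converges
        at \<open>z\<close>.\<close>
      then obtain q where q: "cmod (z - X) < q" "q < r" using dense by blast
      have "q \<ge> 0" using q(1) norm_ge_zero[of "z - X"] by linarith
      then have "(\<lambda>n. (x + q - x) ^ n *\<^sub>R c n) sums g (x + q)"
        using q by (intro sums) auto
      then have "summable (\<lambda>n. c n * (of_real q) ^ n)"
        by (auto simp: sums_iff scaleR_conv_of_real mult.commute)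
      then have "summable (\<lambda>n. c n * (z - X) ^ n)"
        by (rule powser_inside) (use q \<open>q \<ge> 0\<close> in auto)
      then show ?thesis unfolding F_def by (rule summable_sums)
    qed
    have Fhol: "F holomorphic_on ball X r"
      by (rule power_series_holomorphic) (rule Fsums)
    have Fg: "F (of_real y) = g y" if "\<bar>y - x\<bar> < r" for y
    proof -
      have "complex_of_real y \<in> ball X r"
        using that by (simp add: X_def dist_norm norm_minus_commute flip: of_real_diff)
      from Fsums[OF this] sums[OF that] show ?thesis
        by (auto simp: X_def scaleR_conv_of_real mult.commute intro: sums_unique2)
    qed
    define D where "D z = F z - C * z ^ n" for z
    have Dhol: "D holomorphic_on ball X r"
      unfolding D_def using Fhol by (intro holomorphic_intros)
    have step: "P w" if uv: "u \<in> ball x r" "w \<in> ball x r" "P u" for u w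
    proof -
      obtain e where e: "e > 0" "\<And>y. dist y u < e \<Longrightarrow> g y = C * of_real y ^ n"
        using uv(3) unfolding P_def eventually_nhds_metric by blast
      obtain e' where e': "e' > 0" "ball u e' \<subseteq> ball x r"
        using uv(1) by (meson open_ball open_contains_ball)
      define V where "V = ball u (min e e')"
      have V: "V \<subseteq> ball x r" using e' by (auto simp: V_def)
      have Dz: "D z = 0" if z: "z \<in> ball X r" for z
      proof (rule analytic_continuation[OF Dhol, of "of_real ` V" "of_real u"])
        show "complex_of_real ` V \<subseteq> ball X r"
          using V by (auto simp: X_def dist_norm simp flip: of_real_diff)
        show "complex_of_real u \<in> ball X r"
          using uv(1) by (auto simp: X_def dist_norm simp flip: of_real_diff)
        have "u islimpt V"
          unfolding V_def using e e' by (intro interior_limit_point) (auto simp: interior_open)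
        then show "complex_of_real u islimpt of_real ` V"
          by (auto simp: islimpt_approachable dist_of_real)
        show "D w = 0" if "w \<in> complex_of_real ` V" for w
        proof -
          obtain t where t: "w = of_real t" "t \<in> V" using \<open>w \<in> _\<close> by auto
          then have "g t = C * of_real t ^ n" by (intro e) (auto simp: V_def dist_commute)
          moreover have "\<bar>t - x\<bar> < r" using t V by (auto simp: dist_real_def abs_minus_commute)
          ultimately show ?thesis using Fg[of t] t by (simp add: D_def)
        qed
      qed (use z in auto)
      have "eventually (\<lambda>y. y \<in> ball x r) (nhds w)"
        using uv by (intro eventually_nhds_in_open) auto
      then show "P w"
        unfolding P_def
      proof eventually_elim
        case (elim y)
        then have y: "\<bar>y - x\<bar> < r" by (simp add: dist_real_def abs_minus_commute)
        then have "complex_of_real y \<in> ball X r"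
          by (simp add: X_def dist_norm norm_minus_commute flip: of_real_diff)
        from Dz[OF this] Fg[OF y] show ?case by (simp add: D_def)
      qed
    qed
    show "\<exists>T. openin (top_of_set {0<..}) T \<and> x \<in> T \<and> (\<forall>u\<in>T. \<forall>w\<in>T. P u \<longrightarrow> P w)"
    proof (intro exI conjI ballI impI)
      show "openin (top_of_set {0<..}) ({0<..} \<inter> ball x r)" by (rule openin_open_Int) simp
      show "x \<in> {0<..} \<inter> ball x r" using r x by simp
    qed (rule step; simp)
  qed (use ab y in auto)
  then show ?thesis unfolding P_def by (rule eventually_nhds_x_imp_x)
qed

section \<open>Elementary inequalities for positive definite functions\<close>

lemma pos_def_functions_finite_sum:
  fixes \<xi> :: "'i \<Rightarrow> 'e::real_vector"
  assumes "f \<in> pos_def_functions" "finite S"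
  shows "0 \<le> (\<Sum>i\<in>S. \<Sum>j\<in>S. a i * f (\<xi> i - \<xi> j) * cnj (a j))"
proof -
  obtain b where b: "bij_betw b {..<card S} S"
    using bij_betw_from_nat_into_finite[OF assms(2)] by blast
  have "0 \<le> (\<Sum>i<card S. \<Sum>j<card S. a (b i) * f (\<xi> (b i) - \<xi> (b j)) * cnj (a (b j)))"
    using assms(1) unfolding pos_def_functions_def by (auto dest: spec[of _ "\<lambda>i. \<xi> (b i)"])
  also have "\<dots> = (\<Sum>i<card S. \<Sum>j\<in>S. a (b i) * f (\<xi> (b i) - \<xi> j) * cnj (a j))"
    by (intro sum.cong refl sum.reindex_bij_betw[OF b])
  also have "\<dots> = (\<Sum>i\<in>S. \<Sum>j\<in>S. a i * f (\<xi> i - \<xi> j) * cnj (a j))"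
    by (rule sum.reindex_bij_betw[OF b])
  finally show ?thesis .
qed

lemma pos_def_functions_two_points:
  assumes "f \<in> pos_def_functions"
  shows "0 \<le> f 0 + f x * cnj c + (c * f (- x) + c * f 0 * cnj c)"
  using pos_def_functions_finite_sum[OF assms, of "{..<2::nat}" "\<lambda>i. if i = 0 then 1 else c" "\<lambda>i. if i = 0 then x else 0"]
  by (simp add: numeral_2_eq_2)

text \<open>The two-point sums must be real. Weight 0 shows that \<open>f 0\<close> is real; then
  weight 1 makes the imaginary parts of \<open>f x\<close> and \<open>f (- x)\<close> opposite, and
  weight \<open>\<i>\<close> makes their real parts equal.\<close>

lemma pos_def_functions_minus:
  assumes "f \<in> pos_def_functions"
  shows "f (- x) = cnj (f x)"
proof -
  have "0 \<le> f 0 + f 0 * cnj 0 + (0 * f (- 0) + 0 * f 0 * cnj 0)"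
    by (rule pos_def_functions_two_points[OF assms])
  then have 0: "Im (f 0) = 0" by (simp add: less_eq_complex_def)
  from pos_def_functions_two_points[OF assms, of x 1] pos_def_functions_two_points[OF assms, of x \<i>] 0
  show ?thesis by (simp add: less_eq_complex_def complex_eq_iff)
qed

lemma pos_def_functions_abs_le:
  assumes "f \<in> pos_def_functions"
  shows "\<bar>Re (f x)\<bar> \<le> Re (f 0)"
proof -
  have "f (- x) = cnj (f x)" by (rule pos_def_functions_minus[OF assms])
  then have "0 \<le> Re (f 0) + Re (f x)" "0 \<le> Re (f 0) - Re (f x)"
    using pos_def_functions_two_points[OF assms, of x 1] pos_def_functions_two_points[OF assms, of x "-1"]
    by (simp_all add: less_eq_complex_def)
  then show ?thesis by linarith
qed

section \<open>Continuity along lines\<close>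

lemma independent_extend_list:
  assumes "finite_dim_subspace (UNIV :: 'e::real_vector set)" "(t :: 'e) \<noteq> 0"
  shows "\<exists>es. distinct (t # es) \<and> independent (set (t # es)) \<and> span (set (t # es)) = UNIV"
proof -
  obtain B :: "'e set" where B: "finite B" "span B = UNIV"
    using assms(1) unfolding finite_dim_subspace_def by auto
  have ind: "independent {t}" using assms(2) by (simp add: dependent_single)
  define E where "E = extend_basis {t}"
  have E: "independent E" "span E = UNIV" "t \<in> E"
    using independent_extend_basis[OF ind] span_extend_basis[OF ind] extend_basis_superset[OF ind]
    by (auto simp: E_def)
  have "finite E" using independent_span_bound[OF B(1) E(1)] B(2) by auto
  then obtain es where es: "set es = E - {t}" "distinct es" by (meson finite_Diff finite_distinct_list)
  have "set (t # es) = E" using es E by auto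
  then show ?thesis using es E by (intro exI[of _ es]) auto
qed

text \<open>On a finite-dimensional space \<open>C_functions\<close> speaks only of coordinates of
  the whole space, so \<open>t\<close> is made the first vector of a basis. Otherwise
  \<open>span {t}\<close> is itself an admissible subspace. In both cases the line is the first
  coordinate axis.\<close>

lemma C_functions_continuous_on_line:
  fixes h :: "'e::real_vector \<Rightarrow> real"
  assumes "h \<in> C_functions" "t \<noteq> 0"
  shows "continuous_on UNIV (\<lambda>\<tau>. h (\<tau> *\<^sub>R t))"
proof -
  obtain es where es: "continuous_map (Euclidean_space (length (t # es))) euclidean
          (\<lambda>x. h (\<Sum>i<length (t # es). x i *\<^sub>R (t # es) ! i))"
  proof (cases "finite_dim_subspace (UNIV :: 'e set)")
    case True
    then obtain es where "distinct (t # es) \<and> independent (set (t # es)) \<and> span (set (t # es)) = UNIV"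
      using independent_extend_list assms(2) by blast
    then show ?thesis using assms(1) True that
      unfolding C_functions_def continuous_in_coordinates_def by (simp only: mem_Collect_eq if_True) blast
  next
    case False
    have "finite_dim_subspace (span {t})" unfolding finite_dim_subspace_def by blast
    moreover have "distinct [t] \<and> independent (set [t]) \<and> span (set [t]) = span {t}"
      using assms(2) by (simp add: dependent_single)
    ultimately show ?thesis using assms(1) False that[of "[]"]
      unfolding C_functions_def continuous_in_coordinates_def by (simp only: mem_Collect_eq if_False) blast
  qed
  define e where "e \<tau> = (\<lambda>i::nat. if i = 0 then \<tau> else 0)" for \<tau> :: real
  have "continuous_map euclidean (Euclidean_space (length (t # es))) e"
    unfolding Euclidean_space_def continuous_map_in_subtopology
    by (auto simp: e_def continuous_map_componentwise_UNIV)
  from continuous_map_compose[OF this es]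
  have "continuous_map euclidean euclidean (\<lambda>\<tau>. h (\<Sum>i<length (t # es). e \<tau> i *\<^sub>R (t # es) ! i))"
    by (simp add: o_def)
  moreover have "(\<Sum>i<length (t # es). e \<tau> i *\<^sub>R (t # es) ! i) = \<tau> *\<^sub>R t" for \<tau>
    unfolding e_def by (simp add: sum.lessThan_Suc_shift del: sum.lessThan_Suc)
  ultimately show ?thesis by simp
qed

section \<open>Monotonicity\<close>

lemma hankel_scale:
  fixes \<rho> :: "real \<Rightarrow> real"
  assumes m: "m \<ge> 1" and c: "c > 0"
  shows "(\<integral>u. indicator {0..} u * (u ^ (m - 1) * k (s * u) * \<rho> (u / c)) \<partial>lborel) =
     c ^ m * (\<integral>u. indicator {0..} u * (u ^ (m - 1) * k (s * c * u) * \<rho> u) \<partial>lborel)"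
proof -
  have "(\<integral>u. indicator {0..} u * (u ^ (m - 1) * k (s * u) * \<rho> (u / c)) \<partial>lborel) =
     c * (\<integral>u. indicator {0..} (c * u) * ((c * u) ^ (m - 1) * k (s * (c * u)) * \<rho> u) \<partial>lborel)"
    using c by (subst lborel_integral_real_affine[of c _ 0]) auto
  also have "(\<integral>u. indicator {0..} (c * u) * ((c * u) ^ (m - 1) * k (s * (c * u)) * \<rho> u) \<partial>lborel)
    = (\<integral>u. c ^ (m - 1) * (indicator {0..} u * (u ^ (m - 1) * k (s * c * u) * \<rho> u)) \<partial>lborel)"
    using c by (intro Bochner_Integration.integral_cong)
      (auto simp: indicator_def zero_le_mult_iff power_mult_distrib mult_ac)
  also have "\<dots> = c ^ (m - 1) * (\<integral>u. indicator {0..} u * (u ^ (m - 1) * k (s * c * u) * \<rho> u) \<partial>lborel)"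
    by (rule integral_mult_right_zero)
  finally show ?thesis using m by (cases m) auto
qed

lemma integrable_scale:
  fixes \<rho> :: "real \<Rightarrow> real"
  assumes c: "c > 0" and int: "integrable lborel (\<lambda>u. indicator {0..} u * (u ^ n * \<rho> u))"
  shows "integrable lborel (\<lambda>u. indicator {0..} u * (u ^ n * \<rho> (u / c)))"
proof -
  have "integrable lborel (\<lambda>u. c ^ n * (indicator {0..} (0 + 1 / c * u) * ((0 + 1 / c * u) ^ n * \<rho> (0 + 1 / c * u))))"
    using c by (intro integrable_mult_right lborel_integrable_real_affine[OF int]) auto
  also have "(\<lambda>u. c ^ n * (indicator {0..} (0 + 1 / c * u) * ((0 + 1 / c * u) ^ n * \<rho> (0 + 1 / c * u)))) =
    (\<lambda>u. indicator {0..} u * (u ^ n * \<rho> (u / c)))"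
    using c by (auto simp: fun_eq_iff indicator_def zero_le_divide_iff power_divide)
  finally show ?thesis .
qed

text \<open>Every ratio \<open>b / a\<close> lies below some power of \<open>q\<close>. A ratio
  above \<open>q\<close> splits into a factor \<open>q\<close> and a rest that the induction
  hypothesis covers.\<close>

lemma local_antimono_imp_antimono:
  fixes F :: "real \<Rightarrow> real"
  assumes q: "q > 1" and F: "\<And>\<sigma> r. \<sigma> > 0 \<Longrightarrow> 1 \<le> r \<Longrightarrow> r \<le> q \<Longrightarrow> F (\<sigma> * r) \<le> F \<sigma>"
    and ab: "0 < a" "a \<le> b"
  shows "F b \<le> F a"
proof -
  have *: "F (\<sigma> * r) \<le> F \<sigma>" if "\<sigma> > 0" "1 \<le> r" "r \<le> q ^ n" for n \<sigma> r
    using that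
  proof (induction n arbitrary: \<sigma> r)
    case (Suc n)
    show ?case
    proof (cases "r \<le> q")
      case False
      then have "F (\<sigma> * q * (r / q)) \<le> F (\<sigma> * q)"
        using Suc.prems q by (intro Suc.IH) (auto simp: field_simps)
      also have "\<dots> \<le> F \<sigma>" using Suc.prems q by (intro F) auto
      finally show ?thesis using q by simp
    qed (use Suc.prems F in auto)
  qed (use F in auto)
  obtain n where "b / a < q ^ n" using real_arch_pow[OF q] by blast
  then have "F (a * (b / a)) \<le> F a" using ab by (intro *[of _ _ n]) auto
  then show ?thesis using ab by simp
qed

theorem theorem5:
  fixes h :: "'e::real_vector \<Rightarrow> real"
    and \<phi> :: "real \<Rightarrow> complex"
    and K :: "(real ^ 'd::finite) \<times> 'e \<Rightarrow> complex"
    and m :: nat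
    and g f :: "real \<Rightarrow> complex"
  defines "K \<equiv> \<lambda>(x, t). of_real (h t powr (- (real CARD('d) / 2))) * \<phi> ((norm x)\<^sup>2 / h t)"
    and "g \<equiv> bessel_transform m \<phi>"
    and "f \<equiv> \<lambda>s. of_real (s powi (int m - int CARD('d))) * g s"
  assumes "h \<in> C_functions" and "\<And>t. h t > 0" and "\<exists>t. h t \<noteq> h 0"
    and "continuous_on {0..} \<phi>" and "\<phi> 0 > 0"
    and "K \<in> pos_def_functions"
    and "1 \<le> m" and "m \<le> CARD('d)"
    and "set_integrable lborel {0..} (\<lambda>u. norm (\<phi> (u\<^sup>2)) * u ^ (m - 1))"
    and "real_analytic_on g {0<..}"
  shows "strict_antimono_on {0<..} f \<and> (\<forall>s>0. g s > 0)"
proof -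
  have h_pos: "h t > 0" for t by fact
  have m: "1 \<le> m" and m_le: "m \<le> CARD('d)" by fact+
  have pd: "K \<in> pos_def_functions" by fact
  define d where "d = CARD('d)"
  define p where "p t = h t powr (- (real d / 2))" for t
  have p_pos: "p t > 0" for t using h_pos[of t] by (simp add: p_def)
  have K: "K (x, t) = of_real (p t) * \<phi> ((norm x)\<^sup>2 / h t)" for x t
    by (simp add: K_def p_def d_def)
  have \<phi>0: "Re (\<phi> 0) > 0" using \<open>\<phi> 0 > 0\<close> by (simp add: less_complex_def)

  \<comment> \<open>The real profile of \<open>\<phi>\<close>, and symmetry and minimum of
    \<open>h\<close>\<close>
  define \<rho> where "\<rho> u = Re (\<phi> (u\<^sup>2))" for u
  \<comment> \<open>Every square occurs as an argument of \<open>\<phi>\<close> on the slice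
    \<open>t = 0\<close>, so properties of \<open>K\<close> on that slice transfer to
    \<open>\<phi>\<close> on the whole half-line.\<close>
  have ex_norm: "\<exists>x :: real ^ 'd. (norm x)\<^sup>2 / h 0 = u\<^sup>2" for u
  proof -
    obtain x :: "real ^ 'd" where "norm x = \<bar>u\<bar> * sqrt (h 0)"
      by (rule vector_choose_size[of "\<bar>u\<bar> * sqrt (h 0)"]) (use h_pos[of 0] in auto)
    then show ?thesis using h_pos[of 0]
      by (intro exI[of _ x]) (simp add: power_mult_distrib)
  qed
  \<comment> \<open>On the slice \<open>t = 0\<close> the function \<open>K\<close> is radial, hence
    even, and positive definiteness makes it Hermitian.\<close>
  have \<phi>_real: "\<phi> (u\<^sup>2) = of_real (\<rho> u)" for u
  proof -
    obtain x :: "real ^ 'd" where x: "(norm x)\<^sup>2 / h 0 = u\<^sup>2" using ex_norm by blast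
    have "K (- (x, 0)) = cnj (K (x, 0))" by (rule pos_def_functions_minus[OF pd])
    then have "Im (\<phi> (u\<^sup>2)) = 0" using p_pos[of 0] by (simp add: K x complex_eq_iff)
    then show ?thesis by (simp add: \<rho>_def complex_eq_iff)
  qed
  have \<rho>_bound: "\<bar>\<rho> u\<bar> \<le> \<rho> 0" for u
  proof -
    obtain x :: "real ^ 'd" where x: "(norm x)\<^sup>2 / h 0 = u\<^sup>2" using ex_norm by blast
    have "\<bar>Re (K (x, 0))\<bar> \<le> Re (K 0)" by (rule pos_def_functions_abs_le[OF pd])
    then have "p 0 * \<bar>\<rho> u\<bar> \<le> p 0 * \<rho> 0"
      using p_pos[of 0] by (simp add: zero_prod_def K x abs_mult \<rho>_def)
    then show ?thesis using p_pos[of 0] by simp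
  qed
  have \<rho>_cont: "continuous_on UNIV \<rho>"
    unfolding \<rho>_def
    by (intro continuous_intros continuous_on_compose2[OF \<open>continuous_on {0..} \<phi>\<close>]) auto
  have [measurable]: "\<rho> \<in> borel_measurable borel"
    using \<rho>_cont by (rule borel_measurable_continuous_onI)
  have \<rho>0: "\<rho> 0 > 0" using \<phi>0 by (simp add: \<rho>_def)
  \<comment> \<open>The real part of \<open>K (0, t)\<close> is a positive multiple of
    \<open>p t\<close>, so \<open>p\<close> is even; \<open>h\<close> is recovered from
    \<open>p\<close> by the inverse power.\<close>
  have h_minus: "h (- t) = h t" for t
  proof -
    have "K (- (0, t)) = cnj (K (0, t))" by (rule pos_def_functions_minus[OF pd])
    then have "Re (K (0, - t)) = Re (K (0, t))" by simp
    then have "p (- t) * Re (\<phi> 0) = p t * Re (\<phi> 0)" unfolding K by simp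
    then have "p (- t) = p t" using \<phi>0 by simp
    moreover have "h \<tau> = p \<tau> powr (- (2 / real d))" for \<tau>
      unfolding p_def powr_powr using h_pos[of \<tau>] by (simp add: d_def)
    ultimately show ?thesis by metis
  qed
  have h_ge: "h 0 \<le> h t" for t
  proof (rule ccontr)
    assume "\<not> h 0 \<le> h t"
    then have "p 0 < p t" unfolding p_def using h_pos by (intro powr_less_mono2_neg) (auto simp: d_def)
    moreover have "\<bar>Re (K (0, t))\<bar> \<le> Re (K 0)" by (rule pos_def_functions_abs_le[OF pd])
    ultimately show False using \<phi>0 p_pos by (simp add: zero_prod_def K abs_mult)
  qed
  have int: "integrable lborel (\<lambda>u. indicator {0..} u * (u ^ (m - 1) * \<rho> u))"
  proof (rule Bochner_Integration.integrable_bound)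
    show "integrable lborel (\<lambda>u. indicator {0..} u *\<^sub>R (norm (\<phi> (u\<^sup>2)) * u ^ (m - 1)))"
      using \<open>set_integrable lborel {0..} (\<lambda>u. norm (\<phi> (u\<^sup>2)) * u ^ (m - 1))\<close> unfolding set_integrable_def .
  qed (auto simp: \<phi>_real abs_mult indicator_def)

  \<comment> \<open>The Hankel transform of the profile and its scaling\<close>
  define T where "T s = (\<integral>u. indicator {0..} u * (u ^ (m - 1) * bessel_kernel m (s * u) * \<rho> u) \<partial>lborel)" for s
  define \<gamma> where "\<gamma> = 2 powr (1 - real m / 2)"
  have \<gamma>: "\<gamma> > 0" by (simp add: \<gamma>_def)
  have g: "g s = of_real (\<gamma> * T s)" if s: "s > 0" for s
  proof -
    have "g s = (\<integral>u. complex_of_real (\<gamma> * (indicator {0..} u * (u ^ (m - 1) * bessel_kernel m (s * u) * \<rho> u))) \<partial>lborel)"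
      unfolding g_def bessel_transform_def set_lebesgue_integral_def
      \<comment> \<open>At \<open>u = 0\<close> the value of \<open>bessel_j\<close> is a limit; the point is discarded as a null set.\<close>
    proof (rule integral_discrete_difference[where X = "{0}"])
      fix u :: real assume "u \<notin> {0}"
      then show "indicator {0..} u *\<^sub>R (\<phi> (u\<^sup>2) * complex_of_real (u ^ (m - 1) * bessel_j (real m / 2 - 1) (s * u))) =
        complex_of_real (\<gamma> * (indicator {0..} u * (u ^ (m - 1) * bessel_kernel m (s * u) * \<rho> u)))"
        using s bessel_j_eq_kernel[OF m, of "s * u"]
        by (cases "u > 0") (auto simp: \<phi>_real \<gamma>_def)
    qed auto
    also have "\<dots> = of_real (\<gamma> * T s)"
      unfolding integral_complex_of_real T_def by simp
    finally show ?thesis .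
  qed
  \<comment> \<open>For \<open>s > 0\<close> this is \<open>f\<close> as a real function, with the
    constant \<open>\<gamma>\<close> split off.\<close>
  define F where "F s = T s / s ^ (d - m)" for s
  have f: "f s = of_real (\<gamma> * F s)" if s: "s > 0" for s
  proof -
    have "int m - int CARD('d) = - int (d - m)" using m_le by (simp add: d_def of_nat_diff)
    then have "s powi (int m - int CARD('d)) = s powi (- int (d - m))" by (simp only:)
    also have "\<dots> = 1 / s ^ (d - m)" by (simp only: power_int_minus power_int_of_nat inverse_eq_divide)
    finally have "s powi (int m - int CARD('d)) = 1 / s ^ (d - m)" .
    then show ?thesis unfolding f_def g[OF s] F_def by (simp only:) simp
  qed
  \<comment> \<open>The exponents of \<open>h t\<close> add up to
    \<open>- d / 2 + m / 2 + (d - m) / 2 = 0\<close>. This is why dividing by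
    \<open>s ^ (d - m)\<close> makes \<open>h t\<close> enter only through the argument of
    \<open>F\<close>.\<close>
  have p_eq: "p t * sqrt (h t) ^ m * sqrt (h t) ^ (d - m) = 1" for t
  proof -
    have "sqrt (h t) ^ m * sqrt (h t) ^ (d - m) = sqrt (h t) powr real d"
      using m_le h_pos[of t] by (simp add: d_def powr_realpow flip: power_add)
    also have "\<dots> = h t powr (real d / 2)"
      using h_pos[of t] by (simp add: powr_powr flip: powr_half_sqrt)
    finally show ?thesis using h_pos[of t] by (simp add: p_def mult.assoc flip: powr_add)
  qed
  have scale: "p t * (sqrt (h t) ^ m * T (s * sqrt (h t))) = s ^ (d - m) * F (s * sqrt (h t))"
    if "s > 0" for s t
  proof -
    have "sqrt (h t) > 0" using h_pos[of t] by simp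
    then have "s ^ (d - m) * F (s * sqrt (h t)) = T (s * sqrt (h t)) / sqrt (h t) ^ (d - m)"
      using that by (simp add: F_def power_mult_distrib)
    also have "\<dots> = (p t * sqrt (h t) ^ m * sqrt (h t) ^ (d - m)) * T (s * sqrt (h t)) / sqrt (h t) ^ (d - m)"
      unfolding p_eq by simp
    also have "\<dots> = p t * (sqrt (h t) ^ m * T (s * sqrt (h t)))"
      using h_pos[of t] by simp
    finally show ?thesis ..
  qed
  \<comment> \<open>The two-point inequality in the second variable, with real weights
    \<open>c0\<close> at 0 and \<open>c1\<close> at \<open>t\<close>, for the partial transform of
    \<open>K\<close>; positive factors common to all terms have been dropped.\<close>
  have pd2: "0 \<le> (c0\<^sup>2 + c1\<^sup>2) * F (s * sqrt (h 0)) + 2 * c0 * c1 * F (s * sqrt (h t))"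
    if s: "s > 0" for c0 c1 s t
  proof -
    \<comment> \<open>The weighted double sum of \<open>K\<close> over the points 0 and
      \<open>t\<close>, as a function of \<open>r = norm x\<close>. Evenness of \<open>h\<close>
      merges the two mixed terms.\<close>
    define A where "A r = (c0\<^sup>2 + c1\<^sup>2) * p 0 * \<rho> (r / sqrt (h 0)) + 2 * c0 * c1 * p t * \<rho> (r / sqrt (h t))" for r
    have K': "K (x, \<tau>) = of_real (p \<tau> * \<rho> (norm x / sqrt (h \<tau>)))" for x \<tau>
      using \<phi>_real[of "norm x / sqrt (h \<tau>)"] h_pos[of \<tau>] by (simp add: K power_divide)
    have p_minus: "p (- t) = p t" by (simp add: p_def h_minus)
    have "0 \<le> (\<integral>u. indicator {0..} u * (u ^ (m - 1) * bessel_kernel m (s * u) * A u) \<partial>lborel)"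
    proof (rule hankel_transform_nonneg[where 'd = 'd, OF _ _ m m_le])
      show "continuous_on UNIV A"
        unfolding A_def using h_pos[of t] h_pos[of 0]
        by (intro continuous_intros continuous_on_compose2[OF \<rho>_cont]) auto
      show "integrable lborel (\<lambda>u. indicator {0..} u * (u ^ (m - 1) * A u))"
      proof -
        have "integrable lborel (\<lambda>u. (c0\<^sup>2 + c1\<^sup>2) * p 0 * (indicator {0..} u * (u ^ (m - 1) * \<rho> (u / sqrt (h 0)))) +
           2 * c0 * c1 * p t * (indicator {0..} u * (u ^ (m - 1) * \<rho> (u / sqrt (h t)))))"
          using h_pos by (intro Bochner_Integration.integrable_add integrable_mult_right integrable_scale int) auto
        then show ?thesis by (simp add: A_def algebra_simps)
      qed
      show "0 \<le> (\<Sum>i<N. \<Sum>j<N. a i * a j * A (norm (x i - x j)))" for N :: nat and x :: "nat \<Rightarrow> real ^ 'd" and a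
      proof -
        \<comment> \<open>Positive definiteness is used at all points
          \<open>(x i, \<tau> b)\<close>, with the product weights \<open>a i * c b\<close>.\<close>
        define S where "S = {..<N} \<times> (UNIV :: bool set)"
        define c where "c b = (if b then c1 else c0)" for b
        define \<tau> where "\<tau> b = (if b then t else 0)" for b
        have inner: "(\<Sum>b\<in>UNIV. \<Sum>b'\<in>UNIV. of_real (a i * c b) * K (x i - x j, \<tau> b - \<tau> b') * cnj (of_real (a j * c b')))
            = complex_of_real (a i * a j * A (norm (x i - x j)))" for i j
          by (simp add: UNIV_bool K' c_def \<tau>_def A_def p_minus h_minus complex_eq_iff power2_eq_square) (simp add: algebra_simps)
        have "0 \<le> (\<Sum>i\<in>S. \<Sum>j\<in>S. of_real (a (fst i) * c (snd i)) * K ((x (fst i), \<tau> (snd i)) - (x (fst j), \<tau> (snd j))) *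
            cnj (of_real (a (fst j) * c (snd j))))"
          by (rule pos_def_functions_finite_sum[OF pd]) (simp add: S_def)
        also have "\<dots> = (\<Sum>i<N. \<Sum>b\<in>UNIV. \<Sum>j<N. \<Sum>b'\<in>UNIV. of_real (a i * c b) * K (x i - x j, \<tau> b - \<tau> b') * cnj (of_real (a j * c b')))"
          by (simp only: S_def sum.cartesian_product' fst_conv snd_conv diff_Pair)
        also have "\<dots> = (\<Sum>i<N. \<Sum>j<N. \<Sum>b\<in>UNIV. \<Sum>b'\<in>UNIV. of_real (a i * c b) * K (x i - x j, \<tau> b - \<tau> b') * cnj (of_real (a j * c b')))"
          by (intro sum.cong refl sum.swap)
        also have "\<dots> = complex_of_real (\<Sum>i<N. \<Sum>j<N. a i * a j * A (norm (x i - x j)))"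
          unfolding inner by simp
        finally show ?thesis by (simp add: less_eq_complex_def)
      qed
    qed
    also have "\<dots> = (\<integral>u. (c0\<^sup>2 + c1\<^sup>2) * p 0 * (indicator {0..} u * (u ^ (m - 1) * bessel_kernel m (s * u) * \<rho> (u / sqrt (h 0)))) +
           2 * c0 * c1 * p t * (indicator {0..} u * (u ^ (m - 1) * bessel_kernel m (s * u) * \<rho> (u / sqrt (h t)))) \<partial>lborel)"
      by (intro Bochner_Integration.integral_cong) (auto simp: A_def algebra_simps)
    also have "\<dots> = (c0\<^sup>2 + c1\<^sup>2) * p 0 * (sqrt (h 0) ^ m * T (s * sqrt (h 0))) + 2 * c0 * c1 * p t * (sqrt (h t) ^ m * T (s * sqrt (h t)))"
    proof -
      have I: "integrable lborel (\<lambda>u. indicator {0..} u * (u ^ (m - 1) * bessel_kernel m (s * u) * \<rho> (u / sqrt (h \<tau>))))" for \<tau>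
      proof -
        have "sqrt (h \<tau>) > 0" using h_pos by simp
        then have "integrable lborel (\<lambda>u. indicator {0..} u * (u ^ (m - 1) * \<rho> (u / sqrt (h \<tau>))))"
          by (rule integrable_scale[OF _ int])
        then show ?thesis
          using radial_integral_cos(3)[of "{..<m}" 0 "\<lambda>u. \<rho> (u / sqrt (h \<tau>))" s] m by simp
      qed
      have S: "(\<integral>u. indicator {0..} u * (u ^ (m - 1) * bessel_kernel m (s * u) * \<rho> (u / sqrt (h \<tau>))) \<partial>lborel)
          = sqrt (h \<tau>) ^ m * T (s * sqrt (h \<tau>))" for \<tau>
        unfolding T_def by (rule hankel_scale[OF m]) (simp add: h_pos)
      show ?thesis
        by (subst Bochner_Integration.integral_add)
          (intro integrable_mult_right I, intro integrable_mult_right I, simp only: integral_mult_right_zero S)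
    qed
    also have "\<dots> = s ^ (d - m) * ((c0\<^sup>2 + c1\<^sup>2) * F (s * sqrt (h 0)) + 2 * c0 * c1 * F (s * sqrt (h t)))"
      unfolding mult.assoc scale[OF s] by (simp add: algebra_simps)
    finally show ?thesis using zero_less_power[OF s, of "d - m"] unfolding zero_le_mult_iff by linarith
  qed

  \<comment> \<open>Nonnegativity and strict decrease\<close>
  have F_nonneg: "F s \<ge> 0" if "s > 0" for s
    using pd2[of "s / sqrt (h 0)" 1 0 0] that h_pos[of 0] by simp
  obtain t where t: "h t \<noteq> h 0" using \<open>\<exists>t. h t \<noteq> h 0\<close> by blast
  then have t_gt: "h t > h 0" using h_ge[of t] by simp
  have t0: "t \<noteq> 0" using t by auto
  define q where "q = sqrt (h t / h 0)"
  have q: "q > 1" unfolding q_def using t_gt h_pos[of 0] by simp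
  \<comment> \<open>The intermediate value theorem on the segment from 0 to \<open>t\<close> yields
    a point where \<open>h\<close> equals \<open>h 0 * r\<^sup>2\<close>. The weights 1 and -1 in
    \<open>pd2\<close>, at frequency \<open>\<sigma> / sqrt (h 0)\<close>, then give the
    comparison.\<close>
  have local: "F (\<sigma> * r) \<le> F \<sigma>" if "\<sigma> > 0" "1 \<le> r" "r \<le> q" for \<sigma> r
  proof -
    have r2: "1 \<le> r\<^sup>2" "r\<^sup>2 \<le> q\<^sup>2" using that by (auto intro: power_mono)
    have "q\<^sup>2 = h t / h 0" using h_pos[of t] h_pos[of 0] by (simp add: q_def)
    then have "h (0 *\<^sub>R t) \<le> h 0 * r\<^sup>2" "h 0 * r\<^sup>2 \<le> h (1 *\<^sub>R t)"
      using mult_left_mono[OF r2(1), of "h 0"] mult_left_mono[OF r2(2), of "h 0"] h_pos[of 0]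
      by (simp_all add: field_simps)
    then obtain \<tau> where "h (\<tau> *\<^sub>R t) = h 0 * r\<^sup>2"
      using IVT'[of "\<lambda>\<tau>. h (\<tau> *\<^sub>R t)" 0 "h 0 * r\<^sup>2" 1]
        continuous_on_subset[OF C_functions_continuous_on_line[OF \<open>h \<in> C_functions\<close> t0]] by auto
    then have "sqrt (h (\<tau> *\<^sub>R t)) = sqrt (h 0) * r" using that by (simp add: real_sqrt_mult)
    then show ?thesis
      using pd2[of "\<sigma> / sqrt (h 0)" 1 "-1" "\<tau> *\<^sub>R t"] that h_pos[of 0] by simp
  qed
  have antimono: "F b \<le> F a" if "0 < a" "a \<le> b" for a b
    using local_antimono_imp_antimono[OF q local that] .
  have strict: "F b < F a" if ab: "0 < a" "a < b" for a b
  proof (rule ccontr)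
    assume "\<not> F b < F a"
    \<comment> \<open>As \<open>F\<close> is nonincreasing, equal values at \<open>a\<close> and
      \<open>b\<close> leave no room in between.\<close>
    then have eq: "F y = F a" if "a \<le> y" "y \<le> b" for y
      using antimono[of a y] antimono[of y b] antimono[of a b] that ab by auto
    have "T y = F a * y ^ (d - m)" if "a \<le> y" "y \<le> b" for y
      using eq[OF that] that ab by (simp add: F_def field_simps)
    then have gy: "g y = of_real (\<gamma> * F a) * of_real y ^ (d - m)" if "a \<le> y" "y \<le> b" for y
      using g[of y] that ab by simp
    have "g s = of_real (\<gamma> * F a) * of_real s ^ (d - m)" if "s > 0" for s
      by (rule real_analytic_on_eq_monomial[OF \<open>real_analytic_on g {0<..}\<close> ab gy that])
    then have "T s = F a * s ^ (d - m)" if "s > 0" for s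
      using g[OF that] that \<gamma> by (metis (no_types, lifting) mult.assoc mult_cancel_left of_real_eq_iff of_real_mult of_real_power less_irrefl)
    then show False
      using hankel_transform_not_monomial[OF m _ \<rho>_cont int \<rho>_bound \<rho>0, of d "F a"] m_le
      unfolding T_def d_def by blast
  qed
  \<comment> \<open>Strict decrease rules out the value 0, since \<open>F (s + 1)\<close> is still
    nonnegative.\<close>
  have F_pos: "F s > 0" if "s > 0" for s
    using strict[of s "s + 1"] F_nonneg[of "s + 1"] that by simp
  have "strict_antimono_on {0<..} f"
  proof (rule monotone_onI)
    fix x y :: real assume "x \<in> {0<..}" "y \<in> {0<..}" "x < y"
    then show "f y < f x"
      using strict[of x y] \<gamma> by (simp add: f less_complex_def)
  qed
  moreover have "g s > 0" if "s > 0" for s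
  proof -
    have "T s > 0" using F_pos[OF that] that by (simp add: F_def zero_less_divide_iff)
    then show ?thesis using g[OF that] \<gamma> by (simp add: less_complex_def)
  qed
  ultimately show ?thesis by blast
qed

end
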